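(* Let $q$ be an odd prime power and let $C$ be the Cartan subgroup of $\mathrm{GL}(2,\mathbb F_q)$. Then $(\mathrm{GL}(2,\mathbb F_q),C,\nu)$ is a multiplicity-free triple for all $\nu\in\widehat{\mathbb F_{q^2}^*}$.
   Context: $\eta$ is a generator of $\mathbb F_q^*$ and $\pm i$ are the square roots of $\eta$ in the quadratic extension $\mathbb F_{q^2}$. The Cartan subgroup is $C=\left\{\begin{pmatrix} a & \eta b \\ b & a \end{pmatrix}:a,b\in\mathbb F_q,(a,b)\ne(0,0)\right\}$, isomorphic to $\mathbb F_{q^2}^*$ via $\begin{pmatrix} a & \eta b \\ b & a \end{pmatrix}\mapsto a+ib$. $\widehat{\mathbb F_{q^2}^*}$ is the group of characters of $\mathbb F_{q^2}^*$; via this isomorphism each $\nu\in\widehat{\mathbb F_{q^2}^*}$ is regarded as a one-dimensional representation of $C$. For a finite group $G$, $K\le G$ and an irreducible $K$-representation $\theta$, $(G,K,\theta)$ is a multiplicity-free triple if $\mathrm{Ind}_K^G\theta$ contains every irreducible $G$-representation at most once. *)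

theory Defs
  imports
    "HOL-Library.Cardinality"
    "HOL-Number_Theory.Prime_Powers"
    "HOL-Algebra.Group"
    "Jordan_Normal_Form.VS_Connect"
begin

section \<open>Complex representations of finite groups\<close>

text \<open>
  Complex vector spaces are module records \<open>V\<close> over \<open>class_ring :: complex ring\<close>; a representation
  of \<open>G\<close> on \<open>V\<close> is a map \<open>\<rho>\<close> for which only the values \<open>\<rho> g v\<close> with \<open>g \<in> carrier G\<close> and
  \<open>v \<in> carrier V\<close> matter. All representations are finite-dimensional.
\<close>

abbreviation complex_field :: "complex ring" where
  "complex_field \<equiv> class_ring"

definition representation ::
  "('g, 'a) monoid_scheme \<Rightarrow> (complex, 'v, 'b) module_scheme \<Rightarrow> ('g \<Rightarrow> 'v \<Rightarrow> 'v) \<Rightarrow> bool" where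
  "representation G V \<rho> \<longleftrightarrow>
     group G \<and> vectorspace complex_field V \<and> vectorspace.fin_dim complex_field V \<and>
     (\<forall>g\<in>carrier G. linear_map complex_field V V (\<rho> g)) \<and>
     (\<forall>v\<in>carrier V. \<rho> \<one>\<^bsub>G\<^esub> v = v) \<and>
     (\<forall>g\<in>carrier G. \<forall>h\<in>carrier G. \<forall>v\<in>carrier V. \<rho> (g \<otimes>\<^bsub>G\<^esub> h) v = \<rho> g (\<rho> h v))"

definition invariant_subspace ::
  "('g, 'a) monoid_scheme \<Rightarrow> (complex, 'v, 'b) module_scheme \<Rightarrow> ('g \<Rightarrow> 'v \<Rightarrow> 'v) \<Rightarrow> 'v set \<Rightarrow> bool" where
  "invariant_subspace G V \<rho> W \<longleftrightarrow>
     subspace complex_field W V \<and> (\<forall>g\<in>carrier G. \<forall>w\<in>W. \<rho> g w \<in> W)"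

definition irreducible_representation ::
  "('g, 'a) monoid_scheme \<Rightarrow> (complex, 'v, 'b) module_scheme \<Rightarrow> ('g \<Rightarrow> 'v \<Rightarrow> 'v) \<Rightarrow> bool" where
  "irreducible_representation G V \<rho> \<longleftrightarrow>
     representation G V \<rho> \<and> carrier V \<noteq> {\<zero>\<^bsub>V\<^esub>} \<and>
     (\<forall>W. invariant_subspace G V \<rho> W \<longrightarrow> W = {\<zero>\<^bsub>V\<^esub>} \<or> W = carrier V)"

definition equivalent_representations ::
  "('g, 'a) monoid_scheme \<Rightarrow> (complex, 'u, 'b) module_scheme \<Rightarrow> ('g \<Rightarrow> 'u \<Rightarrow> 'u) \<Rightarrow>
   (complex, 'v, 'c) module_scheme \<Rightarrow> ('g \<Rightarrow> 'v \<Rightarrow> 'v) \<Rightarrow> bool" where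
  "equivalent_representations G U \<sigma> V \<rho> \<longleftrightarrow>
     (\<exists>T. linear_map complex_field U V T \<and> bij_betw T (carrier U) (carrier V) \<and>
          (\<forall>g\<in>carrier G. \<forall>u\<in>carrier U. T (\<sigma> g u) = \<rho> g (T u)))"

text \<open>
  \<open>contains_copies G V \<rho> U \<sigma> m\<close>: some \<open>m\<close> subrepresentations of \<open>(\<rho>, V)\<close>, each equivalent to
  \<open>(\<sigma>, U)\<close>, form a direct sum inside \<open>V\<close>. For irreducible \<open>\<sigma>\<close>, the largest such \<open>m\<close> is the
  multiplicity of \<open>\<sigma>\<close> in \<open>\<rho>\<close>.
\<close>

definition contains_copies ::
  "('g, 'a) monoid_scheme \<Rightarrow> (complex, 'v, 'b) module_scheme \<Rightarrow> ('g \<Rightarrow> 'v \<Rightarrow> 'v) \<Rightarrow>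
   (complex, 'u, 'c) module_scheme \<Rightarrow> ('g \<Rightarrow> 'u \<Rightarrow> 'u) \<Rightarrow> nat \<Rightarrow> bool" where
  "contains_copies G V \<rho> U \<sigma> m \<longleftrightarrow>
     (\<exists>W :: nat \<Rightarrow> 'v set.
        (\<forall>j<m. invariant_subspace G V \<rho> (W j) \<and>
               equivalent_representations G U \<sigma> (V\<lparr>carrier := W j\<rparr>) \<rho>) \<and>
        (\<forall>w. (\<forall>j<m. w j \<in> W j) \<and> (\<Oplus>\<^bsub>V\<^esub>j\<in>{..<m}. w j) = \<zero>\<^bsub>V\<^esub> \<longrightarrow> (\<forall>j<m. w j = \<zero>\<^bsub>V\<^esub>)))"

text \<open>
  Quantifying over irreducible representations on the spaces \<open>\<complex>\<^sup>n\<close> covers all irreducible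
  representations up to equivalence, since they are finite-dimensional.
\<close>

definition multiplicity_free ::
  "('g, 'a) monoid_scheme \<Rightarrow> (complex, 'v, 'b) module_scheme \<Rightarrow> ('g \<Rightarrow> 'v \<Rightarrow> 'v) \<Rightarrow> bool" where
  "multiplicity_free G V \<rho> \<longleftrightarrow>
     (\<forall>n \<sigma>. irreducible_representation G (module_vec TYPE(complex) n) \<sigma> \<longrightarrow>
        (\<forall>m. contains_copies G V \<rho> (module_vec TYPE(complex) n) \<sigma> m \<longrightarrow> m \<le> 1))"


section \<open>Induced representations\<close>

text \<open>
  The space of \<open>Ind\<^sub>K\<^sup>G \<theta>\<close> is \<open>{F : G \<rightarrow> V. F (g k) = \<theta> (k\<^sup>-\<^sup>1) (F g)}\<close>, with \<open>G\<close> acting by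
  \<open>(g F) x = F (g\<^sup>-\<^sup>1 x)\<close>. Functions are normalised to be \<open>undefined\<close> outside \<open>carrier G\<close>.
  The fields \<open>mult\<close> and \<open>one\<close> of a module record play no role.
\<close>

definition induced_space ::
  "('g, 'a) monoid_scheme \<Rightarrow> 'g set \<Rightarrow> (complex, 'v, 'b) module_scheme \<Rightarrow> ('g \<Rightarrow> 'v \<Rightarrow> 'v) \<Rightarrow>
   (complex, 'g \<Rightarrow> 'v) module" where
  "induced_space G K V \<theta> =
     \<lparr>carrier = {F \<in> carrier G \<rightarrow>\<^sub>E carrier V.
                   \<forall>g\<in>carrier G. \<forall>k\<in>K. F (g \<otimes>\<^bsub>G\<^esub> k) = \<theta> (inv\<^bsub>G\<^esub> k) (F g)},
      mult = undefined,
      one = undefined,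
      zero = (\<lambda>x\<in>carrier G. \<zero>\<^bsub>V\<^esub>),
      add = (\<lambda>F F'. \<lambda>x\<in>carrier G. F x \<oplus>\<^bsub>V\<^esub> F' x),
      smult = (\<lambda>c F. \<lambda>x\<in>carrier G. c \<odot>\<^bsub>V\<^esub> F x)\<rparr>"

definition induced_action ::
  "('g, 'a) monoid_scheme \<Rightarrow> 'g \<Rightarrow> ('g \<Rightarrow> 'v) \<Rightarrow> 'g \<Rightarrow> 'v" where
  "induced_action G g F = (\<lambda>x\<in>carrier G. F (inv\<^bsub>G\<^esub> g \<otimes>\<^bsub>G\<^esub> x))"

definition multiplicity_free_triple ::
  "('g, 'a) monoid_scheme \<Rightarrow> 'g set \<Rightarrow> (complex, 'v, 'b) module_scheme \<Rightarrow> ('g \<Rightarrow> 'v \<Rightarrow> 'v) \<Rightarrow> bool" where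
  "multiplicity_free_triple G K V \<theta> \<longleftrightarrow>
     group G \<and> finite (carrier G) \<and> subgroup K G \<and>
     irreducible_representation (G\<lparr>carrier := K\<rparr>) V \<theta> \<and>
     multiplicity_free G (induced_space G K V \<theta>) (induced_action G)"

definition complex_line :: "(complex, complex) module" where
  "complex_line =
     \<lparr>carrier = UNIV, mult = (*), one = 1, zero = 0, add = (+), smult = (*)\<rparr>"

definition one_dim_action :: "('g \<Rightarrow> complex) \<Rightarrow> 'g \<Rightarrow> complex \<Rightarrow> complex" where
  "one_dim_action \<chi> g v = \<chi> g * v"

definition characters :: "('g, 'a) monoid_scheme \<Rightarrow> ('g \<Rightarrow> complex) set" where
  "characters G = hom G (units_of complex_field)"


section \<open>The Cartan subgroup of \<open>GL(2, F)\<close>\<close>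

definition general_linear_group :: "nat \<Rightarrow> 'f::field mat monoid" where
  "general_linear_group n = units_of (ring_mat TYPE('f) n ())"

definition cartan_subgroup :: "'f::field \<Rightarrow> 'f mat set" where
  "cartan_subgroup \<eta> =
     {mat_of_rows_list 2 [[a, \<eta> * b], [b, a]] | a b. (a, b) \<noteq> (0, 0)}"

text \<open>
  Here \<open>\<iota>\<close> is the embedding of the base field into its quadratic extension. The entries in the
  first column of a Cartan matrix are \<open>a\<close> and \<open>b\<close>, so on Cartan matrices this is the map to
  \<open>a + ib\<close>.
\<close>

definition cartan_to_ext :: "('f::field \<Rightarrow> 'k::field) \<Rightarrow> 'k \<Rightarrow> 'f mat \<Rightarrow> 'k" where
  "cartan_to_ext \<iota> i A = \<iota> (A $$ (0, 0)) + i * \<iota> (A $$ (1, 0))"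

end

theory Submission
  imports Defs "HOL-Computational_Algebra.Fundamental_Theorem_Algebra"
begin

text \<open>
  Gelfand's trick. Let \<open>\<chi>\<close> be the character of the Cartan subgroup \<open>C\<close>. A transpose, conjugated
  by a diagonal matrix, is an anti-automorphism \<open>\<tau>\<close> of \<open>GL(2, q)\<close> that fixes \<open>C\<close> pointwise, and
  every \<open>\<tau> g\<close> is conjugate to \<open>g\<close> by an element of \<open>C\<close>. So if \<open>\<Pi>\<close> is the projection of a
  representation \<open>\<sigma>\<close> to its \<open>\<chi>\<close>-isotypic part under \<open>C\<close>, then \<open>\<Pi> \<sigma>(g) \<Pi> = \<Pi> \<sigma>(\<tau> g) \<Pi>\<close>, and these
  operators commute. They have a common eigenvector \<open>u\<close> in the isotypic part, and a functional \<open>l\<close>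
  with \<open>l (\<sigma>(k) v) = \<chi>(k) l(v)\<close> satisfies \<open>l (\<sigma>(g) u) = c\<^sub>g l(u)\<close>, with \<open>c\<^sub>g\<close> independent of \<open>l\<close>. If
  \<open>\<sigma>\<close> is irreducible, then \<open>u\<close> generates the whole space, so \<open>l\<close> is determined by \<open>l(u)\<close>. By Frobenius
  reciprocity (evaluate at the identity), two embeddings of \<open>\<sigma>\<close> into the induced representation
  are proportional.
\<close>

section \<open>Common eigenvectors in \<open>\<complex>\<^sup>n\<close>\<close>

abbreviation cvec :: "nat \<Rightarrow> (complex, complex vec) module" where
  "cvec n \<equiv> module_vec TYPE(complex) n"

text \<open>Written coordinatewise, so that ordinary sums of complex numbers do the work and the
  result lies in \<open>carrier_vec n\<close> whatever the vectors \<open>x k\<close> are.\<close>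

definition vec_sum :: "nat \<Rightarrow> 'i set \<Rightarrow> ('i \<Rightarrow> complex) \<Rightarrow> ('i \<Rightarrow> complex vec) \<Rightarrow> complex vec" where
  "vec_sum n S c x = vec n (\<lambda>r. \<Sum>k\<in>S. c k * x k $ r)"

lemma vec_sum_carrier [simp]: "vec_sum n S c x \<in> carrier_vec n"
  by (simp add: vec_sum_def)

lemma vec_sum_empty: "vec_sum n {} c x = 0\<^sub>v n"
  by (auto simp: vec_sum_def)

lemma vec_sum_insert:
  assumes "finite S" "a \<notin> S" "x a \<in> carrier_vec n"
  shows "vec_sum n (insert a S) c x = c a \<cdot>\<^sub>v x a + vec_sum n S c x"
  using assms by (intro eq_vecI) (auto simp: vec_sum_def)

lemma vec_sum_cong:
  assumes "\<And>k. k \<in> S \<Longrightarrow> c k = d k" "\<And>k. k \<in> S \<Longrightarrow> x k = y k"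
  shows "vec_sum n S c x = vec_sum n S d y"
  using assms by (intro eq_vecI) (auto simp: vec_sum_def intro!: sum.cong)

lemma vec_sum_reindex:
  assumes "bij_betw h S T"
  shows "vec_sum n T c x = vec_sum n S (\<lambda>k. c (h k)) (\<lambda>k. x (h k))"
  unfolding vec_sum_def
  by (intro eq_vecI) (auto intro!: sum.reindex_bij_betw [OF assms, symmetric])

lemma vec_sum_smult:
  assumes "\<And>k. k \<in> S \<Longrightarrow> x k \<in> carrier_vec n"
  shows "a \<cdot>\<^sub>v vec_sum n S c x = vec_sum n S (\<lambda>k. a * c k) x"
  using assms by (intro eq_vecI) (auto simp: vec_sum_def sum_distrib_left mult.assoc)

lemma module_cvec: "module complex_field (cvec n)"
  using vec_module by blast

lemma smult_zero_cvec: "c \<cdot>\<^sub>v 0\<^sub>v n = (0\<^sub>v n :: complex vec)"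
  by auto

lemma zero_smult_cvec: "v \<in> carrier_vec n \<Longrightarrow> 0 \<cdot>\<^sub>v v = (0\<^sub>v n :: complex vec)"
  by auto

lemma cvec_homD:
  assumes "f \<in> module_hom complex_field (cvec n) (cvec n)"
  shows "v \<in> carrier_vec n \<Longrightarrow> f v \<in> carrier_vec n"
    and "v \<in> carrier_vec n \<Longrightarrow> w \<in> carrier_vec n \<Longrightarrow> f (v + w) = f v + f w"
    and "v \<in> carrier_vec n \<Longrightarrow> f (c \<cdot>\<^sub>v v) = c \<cdot>\<^sub>v f v"
    and "f (0\<^sub>v n) = 0\<^sub>v n"
proof -
  show 1: "v \<in> carrier_vec n \<Longrightarrow> f v \<in> carrier_vec n" for v
    using assms by (auto simp: module_hom_def module_vec_simps)
  show "v \<in> carrier_vec n \<Longrightarrow> w \<in> carrier_vec n \<Longrightarrow> f (v + w) = f v + f w"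
    using assms by (auto simp: module_hom_def module_vec_simps)
  show 2: "v \<in> carrier_vec n \<Longrightarrow> f (c \<cdot>\<^sub>v v) = c \<cdot>\<^sub>v f v" for c v
    using assms by (auto simp: module_hom_def module_vec_simps)
  have "f (0 \<cdot>\<^sub>v 0\<^sub>v n) = 0 \<cdot>\<^sub>v f (0\<^sub>v n)" by (rule 2) simp
  then show "f (0\<^sub>v n) = 0\<^sub>v n" using 1 [of "0\<^sub>v n"] by (simp add: zero_smult_cvec smult_zero_cvec)
qed

lemma cvec_submoduleD:
  assumes "submodule complex_field W (cvec n)"
  shows "W \<subseteq> carrier_vec n"
    and "0\<^sub>v n \<in> W"
    and "v \<in> W \<Longrightarrow> w \<in> W \<Longrightarrow> v + w \<in> W"
    and "v \<in> W \<Longrightarrow> c \<cdot>\<^sub>v v \<in> W"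
  using assms by (auto simp: submodule_def module_vec_simps)

lemma cvec_submoduleI:
  assumes "W \<subseteq> carrier_vec n" "0\<^sub>v n \<in> W"
    and "\<And>v w. v \<in> W \<Longrightarrow> w \<in> W \<Longrightarrow> v + w \<in> W"
    and "\<And>c v. v \<in> W \<Longrightarrow> c \<cdot>\<^sub>v v \<in> W"
  shows "submodule complex_field W (cvec n)"
  using assms by (auto simp: submodule_def module_vec_simps module_cvec)

lemma hom_vec_sum:
  assumes f: "f \<in> module_hom complex_field (cvec n) (cvec n)"
    and "finite S" "\<And>k. k \<in> S \<Longrightarrow> x k \<in> carrier_vec n"
  shows "f (vec_sum n S c x) = vec_sum n S c (\<lambda>k. f (x k))"
  using assms(2,3)
  by (induction S rule: finite_induct) (auto simp: vec_sum_empty vec_sum_insert cvec_homD [OF f])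

lemma functional_vec_sum:
  fixes l :: "complex vec \<Rightarrow> complex"
  assumes add: "\<And>v w. v \<in> carrier_vec n \<Longrightarrow> w \<in> carrier_vec n \<Longrightarrow> l (v + w) = l v + l w"
    and smult: "\<And>c v. v \<in> carrier_vec n \<Longrightarrow> l (c \<cdot>\<^sub>v v) = c * l v"
    and "finite S" "\<And>k. k \<in> S \<Longrightarrow> x k \<in> carrier_vec n"
  shows "l (vec_sum n S c x) = (\<Sum>k\<in>S. c k * l (x k))"
proof -
  have "l (0\<^sub>v n) = 0" using smult [of "0\<^sub>v n" 0] by (simp add: smult_zero_cvec)
  with assms(3,4) show ?thesis
    by (induction S rule: finite_induct) (auto simp: vec_sum_empty vec_sum_insert add smult)
qed

lemma submodule_vec_sum:
  assumes W: "submodule complex_field W (cvec n)"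
    and "finite S" "\<And>k. k \<in> S \<Longrightarrow> x k \<in> W"
  shows "vec_sum n S c x \<in> W"
  using assms(2,3)
proof (induction S rule: finite_induct)
  case empty
  then show ?case by (simp add: vec_sum_empty cvec_submoduleD [OF W])
next
  case (insert a S)
  then show ?case using cvec_submoduleD(1) [OF W]
    by (subst vec_sum_insert) (auto intro!: cvec_submoduleD(3,4) [OF W])
qed

section \<open>Eigenvectors of one operator and of a commuting family\<close>

text \<open>More than \<open>n\<close> vectors in an n-dimensional space are dependent. The
  coefficients of a dependence are stored as a polynomial so that it can be factored later.\<close>

lemma exists_annihilating_poly:
  assumes x: "\<And>j. j \<le> n \<Longrightarrow> x j \<in> carrier_vec n"
  shows "\<exists>p::complex poly. p \<noteq> 0 \<and> degree p \<le> n \<and> vec_sum n {..n} (coeff p) x = 0\<^sub>v n"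
proof -
  \<comment> \<open>The columns are the \<open>x j\<close>, with a zero row appended to make the
    matrix square. Because of that row the transpose kills the last unit vector, so the determinant
    vanishes and \<open>M\<close> has a nonzero kernel vector: the wanted dependence.\<close>
  define M where "M = mat (Suc n) (Suc n) (\<lambda>(r,j). if r < n then x j $ r else 0)"
  have M: "M \<in> carrier_mat (Suc n) (Suc n)" by (simp add: M_def)
  have "transpose_mat M *\<^sub>v unit_vec (Suc n) n = 0\<^sub>v (Suc n)"
    by (intro eq_vecI) (auto simp: M_def scalar_prod_def unit_vec_def sum.delta if_distrib cong: if_cong intro!: sum.neutral)
  moreover have "unit_vec (Suc n) n \<noteq> (0\<^sub>v (Suc n) :: complex vec)"
    by (metis index_unit_vec(2) index_zero_vec(1) lessI zero_neq_one)
  ultimately have "det (transpose_mat M) = 0"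
    using det_0_iff_vec_prod_zero [of "transpose_mat M" "Suc n"] M
    by (metis transpose_carrier_mat unit_vec_carrier)
  then obtain c where c: "c \<in> carrier_vec (Suc n)" "c \<noteq> 0\<^sub>v (Suc n)" "M *\<^sub>v c = 0\<^sub>v (Suc n)"
    using det_0_iff_vec_prod_zero [OF M] det_transpose [OF M] by auto
  define p where "p = (\<Sum>j\<le>n. monom (c $ j) j)"
  have cf: "coeff p j = (if j \<le> n then c $ j else 0)" for j
    by (simp add: p_def coeff_sum)
  have "p \<noteq> 0"
  proof
    assume "p = 0"
    then have "c $ j = 0" if "j \<le> n" for j using cf [of j] that by simp
    then have "c = 0\<^sub>v (Suc n)" using c(1) by (intro eq_vecI) auto
    with c(2) show False by simp
  qed
  moreover have "degree p \<le> n" by (rule degree_le) (simp add: cf)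
  moreover have "vec_sum n {..n} (coeff p) x = 0\<^sub>v n"
  proof (intro eq_vecI)
    fix r assume r: "r < dim_vec (0\<^sub>v n :: complex vec)"
    then have "0 = (M *\<^sub>v c) $ r" using c(3) by simp
    also have "\<dots> = (\<Sum>j = 0..<Suc n. x j $ r * c $ j)"
      using r c(1) by (simp add: M_def scalar_prod_def)
    also have "\<dots> = (\<Sum>j\<le>n. x j $ r * c $ j)"
      by (simp only: atLeast0LessThan lessThan_Suc_atMost)
    finally show "vec_sum n {..n} (coeff p) x $ r = 0\<^sub>v n $ r"
      using r by (simp add: vec_sum_def cf mult.commute)
  qed (simp add: vec_sum_def)
  ultimately show ?thesis by blast
qed

text \<open>Krylov argument: take a nonzero polynomial \<open>p\<close> of least degree with p(A) w
  = 0 and split off a root, p = (X - z) q. By minimality q(A) w is nonzero, and A - z kills it. It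
  lies in \<open>W\<close> because it is a combination of iterates of \<open>w\<close>.\<close>

lemma exists_eigenvector:
  assumes A: "A \<in> module_hom complex_field (cvec n) (cvec n)"
    and W: "submodule complex_field W (cvec n)" and AW: "\<And>w. w \<in> W \<Longrightarrow> A w \<in> W"
    and w: "w \<in> W" "w \<noteq> 0\<^sub>v n"
  shows "\<exists>c v. v \<in> W \<and> v \<noteq> 0\<^sub>v n \<and> A v = c \<cdot>\<^sub>v v"
proof -
  define x where "x j = (A ^^ j) w" for j
  have xW: "x j \<in> W" for j by (induction j) (simp_all add: x_def w AW)
  then have xc: "x j \<in> carrier_vec n" for j using cvec_submoduleD(1) [OF W] by blast
  have x_Suc: "x (Suc j) = A (x j)" for j by (simp add: x_def)
  \<comment> \<open>This is p(A) w only when \<open>degree p \<le> n\<close>, since the sum is cut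
    off at \<open>n\<close>; hence the degree bound in \<open>P\<close>.\<close>
  define app where "app p = vec_sum n {..n} (coeff p) x" for p :: "complex poly"
  define P where "P p \<longleftrightarrow> p \<noteq> 0 \<and> degree p \<le> n \<and> app p = 0\<^sub>v n" for p
  have "\<exists>p. P p" using exists_annihilating_poly [of n x] xc by (simp add: P_def app_def)
  then obtain p where p: "P p" and min: "\<And>q. degree q < degree p \<Longrightarrow> \<not> P q"
    using exists_least_iff [of "\<lambda>d. \<exists>p. P p \<and> degree p = d"] by (metis (no_types, lifting))
  \<comment> \<open>A nonzero constant would make a nonzero multiple of \<open>w\<close>
    vanish.\<close>
  have "degree p \<noteq> 0"
  proof
    assume "degree p = 0"
    then obtain a where a: "p = [:a:]" by (rule degree_eq_zeroE)
    then have "a \<noteq> 0" using p by (simp add: P_def)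
    have "app p = a \<cdot>\<^sub>v w"
    proof (intro eq_vecI)
      fix r assume "r < dim_vec (a \<cdot>\<^sub>v w)"
      then have r: "r < n" using xc [of 0] by (simp add: x_def)
      have "(\<Sum>k\<le>n. coeff p k * x k $ r) = (\<Sum>k\<in>{0}. coeff p k * x k $ r)"
        by (rule sum.mono_neutral_right) (auto simp: a coeff_pCons split: nat.splits)
      then show "app p $ r = (a \<cdot>\<^sub>v w) $ r"
        using r xc [of 0] by (simp add: app_def vec_sum_def a x_def)
    qed (use xc [of 0] in \<open>simp add: app_def vec_sum_def x_def\<close>)
    then have "a \<cdot>\<^sub>v w = 0\<^sub>v n" using p by (simp add: P_def)
    then have "inverse a \<cdot>\<^sub>v (a \<cdot>\<^sub>v w) = 0\<^sub>v n" by (simp add: smult_zero_cvec)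
    then show False using \<open>a \<noteq> 0\<close> w by (simp add: smult_smult_assoc)
  qed
  then obtain z where "poly p z = 0"
    using fundamental_theorem_of_algebra constant_degree by metis
  then obtain q where q: "p = [:-z, 1:] * q" by (auto simp: poly_eq_0_iff_dvd elim: dvdE)
  have "q \<noteq> 0" using p q by (auto simp: P_def)
  then have deg: "degree p = Suc (degree q)"
    unfolding q by (subst degree_mult_eq) auto
  define v where "v = app q"
  \<comment> \<open>Since \<open>degree q < degree p\<close> and \<open>degree p \<le> n\<close>,
    multiplying \<open>q\<close> by X pushes no term past the cutoff at \<open>n\<close>.\<close>
  have qn: "coeff q n = 0" using deg p by (intro coeff_eq_0) (auto simp: P_def)
  have vc: "v \<in> carrier_vec n" by (simp add: v_def app_def)
  have "v \<noteq> 0\<^sub>v n" using min [of q] deg \<open>q \<noteq> 0\<close> p by (auto simp: P_def v_def)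
  moreover have "v \<in> W" unfolding v_def app_def by (rule submodule_vec_sum [OF W]) (auto simp: xW)
  moreover have "A v = z \<cdot>\<^sub>v v"
  proof (intro eq_vecI)
    fix r assume "r < dim_vec (z \<cdot>\<^sub>v v)"
    then have r: "r < n" using vc by simp
    have Av: "A v = vec_sum n {..n} (coeff q) (\<lambda>j. x (Suc j))"
      unfolding v_def app_def x_Suc by (rule hom_vec_sum [OF A]) (auto simp: xc)
    have "(\<Sum>k\<le>n. coeff (pCons 0 q) k * x k $ r) = (\<Sum>k\<le>Suc n. coeff (pCons 0 q) k * x k $ r)"
      using qn by simp
    also have "\<dots> = (\<Sum>k\<le>n. coeff q k * x (Suc k) $ r)"
      by (subst sum.atMost_Suc_shift) simp
    finally have "(\<Sum>k\<le>n. coeff (pCons 0 q) k * x k $ r) = A v $ r"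
      using r by (simp add: Av vec_sum_def)
    moreover have "app p $ r = 0" using p r by (simp add: P_def)
    moreover have "coeff p k = coeff (pCons 0 q) k - z * coeff q k" for k
      by (simp add: q)
    ultimately have "A v $ r - z * v $ r = 0"
      using r by (simp add: app_def v_def vec_sum_def algebra_simps sum_subtractf sum_distrib_left)
    then show "A v $ r = (z \<cdot>\<^sub>v v) $ r" using r vc by simp
  qed (use vc cvec_homD(1) [OF A vc] in auto)
  ultimately show ?thesis by blast
qed

text \<open>Induction on the family: an eigenspace \<open>W'\<close> of one operator inside
  \<open>W\<close> is stable under the others because they commute with it. Commutation is demanded
  on \<open>W\<close> only, as the operators of the application are shown to commute just on the
  isotypic part.\<close>

lemma exists_common_eigenvector:
  assumes "finite S"
    and A: "\<And>s. s \<in> S \<Longrightarrow> A s \<in> module_hom complex_field (cvec n) (cvec n)"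
    and "submodule complex_field W (cvec n)"
    and "\<And>s w. s \<in> S \<Longrightarrow> w \<in> W \<Longrightarrow> A s w \<in> W"
    and "\<And>s t w. s \<in> S \<Longrightarrow> t \<in> S \<Longrightarrow> w \<in> W \<Longrightarrow> A s (A t w) = A t (A s w)"
    and "w \<in> W" "w \<noteq> 0\<^sub>v n"
  shows "\<exists>v. v \<in> W \<and> v \<noteq> 0\<^sub>v n \<and> (\<forall>s\<in>S. \<exists>c. A s v = c \<cdot>\<^sub>v v)"
  using assms
proof (induction S arbitrary: W w)
  case empty
  then show ?case by auto
next
  case (insert a S)
  note W = insert.prems(2)
  have hom: "A a \<in> module_hom complex_field (cvec n) (cvec n)" using insert.prems(1) by simp
  obtain c v where v: "v \<in> W" "v \<noteq> 0\<^sub>v n" "A a v = c \<cdot>\<^sub>v v"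
    using exists_eigenvector [OF hom W _ insert.prems(5,6)] insert.prems(3) by blast
  define W' where "W' = {u \<in> W. A a u = c \<cdot>\<^sub>v u}"
  note Wc = cvec_submoduleD(1) [OF W]
  have W'sub: "submodule complex_field W' (cvec n)"
  proof (rule cvec_submoduleI)
    show "W' \<subseteq> carrier_vec n" using Wc by (auto simp: W'_def)
    show "0\<^sub>v n \<in> W'" by (simp add: W'_def cvec_submoduleD [OF W] cvec_homD [OF hom] smult_zero_cvec)
    show "x + y \<in> W'" if "x \<in> W'" "y \<in> W'" for x y
      using that Wc smult_add_distrib_vec [of x n y c] subsetD [OF Wc, of x] subsetD [OF Wc, of y]
      by (auto simp: W'_def cvec_submoduleD [OF W] cvec_homD [OF hom])
    show "d \<cdot>\<^sub>v x \<in> W'" if "x \<in> W'" for d x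
      using that subsetD [OF Wc, of x]
      by (auto simp: W'_def cvec_submoduleD [OF W] cvec_homD [OF hom] smult_smult_assoc mult.commute)
  qed
  have "\<exists>v. v \<in> W' \<and> v \<noteq> 0\<^sub>v n \<and> (\<forall>s\<in>S. \<exists>c. A s v = c \<cdot>\<^sub>v v)"
  proof (rule insert.IH [OF _ W'sub])
    show "A s \<in> module_hom complex_field (cvec n) (cvec n)" if "s \<in> S" for s
      using insert.prems(1) that by simp
    show "A s u \<in> W'" if "s \<in> S" "u \<in> W'" for s u
    proof -
      have u: "u \<in> W" "A a u = c \<cdot>\<^sub>v u" using that by (auto simp: W'_def)
      have "A a (A s u) = A s (A a u)" using insert.prems(4) [of a s u] u that by simp
      also have "\<dots> = c \<cdot>\<^sub>v A s u"
        using cvec_homD(3) [of "A s" n u c] insert.prems(1) that u Wc by auto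
      finally show ?thesis using insert.prems(3) that u by (simp add: W'_def)
    qed
    show "A s (A t u) = A t (A s u)" if "s \<in> S" "t \<in> S" "u \<in> W'" for s t u
      using insert.prems(4) that by (simp add: W'_def)
    show "v \<in> W'" "v \<noteq> 0\<^sub>v n" using v by (auto simp: W'_def)
  qed
  then show ?case by (auto simp: W'_def)
qed

section \<open>Gelfand's trick with a character\<close>

text \<open>For the trivial character it would suffice that \<tau> preserves every double coset of
  \<open>K\<close>. For general \<chi> the two factors from \<open>K\<close> must also cancel under
  \<chi>, which is the last condition.\<close>

locale twisted_gelfand_pair = group G for G (structure) +
  fixes K :: "'a set" and \<chi> :: "'a \<Rightarrow> complex" and \<tau> :: "'a \<Rightarrow> 'a"
  assumes finite_G: "finite (carrier G)"
    and subgroup_K: "subgroup K G"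
    and chi_mult: "\<And>k l. k \<in> K \<Longrightarrow> l \<in> K \<Longrightarrow> \<chi> (k \<otimes> l) = \<chi> k * \<chi> l"
    and chi_one: "\<chi> \<one> = 1"
    and tau_closed: "\<And>g. g \<in> carrier G \<Longrightarrow> \<tau> g \<in> carrier G"
    and tau_mult: "\<And>g h. g \<in> carrier G \<Longrightarrow> h \<in> carrier G \<Longrightarrow> \<tau> (g \<otimes> h) = \<tau> h \<otimes> \<tau> g"
    and tau_K: "\<And>k. k \<in> K \<Longrightarrow> \<tau> k = k"
    and tau_double_coset: "\<And>g. g \<in> carrier G \<Longrightarrow>
          \<exists>k\<in>K. \<exists>l\<in>K. \<tau> g = k \<otimes> g \<otimes> l \<and> \<chi> k * \<chi> l = 1"
begin

lemma K_closed: "k \<in> K \<Longrightarrow> k \<in> carrier G"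
  using subgroup.subset [OF subgroup_K] by blast

lemma K_mult: "k \<in> K \<Longrightarrow> l \<in> K \<Longrightarrow> k \<otimes> l \<in> K"
  using subgroup.m_closed [OF subgroup_K] by blast

lemma K_inv: "k \<in> K \<Longrightarrow> inv k \<in> K"
  using subgroup.m_inv_closed [OF subgroup_K] by blast

lemma finite_K: "finite K"
  using finite_G subgroup.subset [OF subgroup_K] finite_subset by blast

lemma card_K: "card K \<noteq> 0"
  using finite_K subgroup.one_closed [OF subgroup_K] by auto

lemma chi_inv_mult: "k \<in> K \<Longrightarrow> \<chi> (inv k) * \<chi> k = 1"
  using chi_mult [of "inv k" k] K_inv [of k] K_closed [of k] chi_one by simp

lemma bij_betw_right_mult: "k \<in> K \<Longrightarrow> bij_betw (\<lambda>l. l \<otimes> k) K K"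
  by (rule bij_betw_byWitness [where f' = "\<lambda>l. l \<otimes> inv k"])
     (auto simp: K_mult K_inv K_closed m_assoc)

lemma bij_betw_left_mult: "k \<in> K \<Longrightarrow> bij_betw (\<lambda>l. k \<otimes> l) K K"
  by (rule bij_betw_byWitness [where f' = "\<lambda>l. inv k \<otimes> l"])
     (auto simp: K_mult K_inv K_closed m_assoc [symmetric])

end

locale twisted_gelfand_rep = twisted_gelfand_pair +
  fixes n :: nat and \<sigma> :: "'a \<Rightarrow> complex vec \<Rightarrow> complex vec"
  assumes sigma_hom: "\<And>g. g \<in> carrier G \<Longrightarrow> \<sigma> g \<in> module_hom complex_field (cvec n) (cvec n)"
    and sigma_one: "\<And>v. v \<in> carrier_vec n \<Longrightarrow> \<sigma> \<one> v = v"
    and sigma_mult: "\<And>g h v. g \<in> carrier G \<Longrightarrow> h \<in> carrier G \<Longrightarrow> v \<in> carrier_vec n \<Longrightarrow>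
          \<sigma> (g \<otimes> h) v = \<sigma> g (\<sigma> h v)"
begin

lemma sigma_closed: "g \<in> carrier G \<Longrightarrow> v \<in> carrier_vec n \<Longrightarrow> \<sigma> g v \<in> carrier_vec n"
  using cvec_homD(1) [OF sigma_hom] .

definition isotypic :: "complex vec set" where
  "isotypic = {v \<in> carrier_vec n. \<forall>k\<in>K. \<sigma> k v = \<chi> k \<cdot>\<^sub>v v}"

text \<open>Up to the factor \<open>card K\<close>, this is the projection onto the \<open>\<chi>\<close>-isotypic subspace.\<close>

definition proj :: "complex vec \<Rightarrow> complex vec" where
  "proj v = vec_sum n K (\<lambda>k. \<chi> (inv k)) (\<lambda>k. \<sigma> k v)"

lemma submodule_isotypic: "submodule complex_field isotypic (cvec n)"
proof (rule cvec_submoduleI)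
  fix v w c assume v: "v \<in> isotypic"
  show "c \<cdot>\<^sub>v v \<in> isotypic"
    using v by (auto simp: isotypic_def cvec_homD(3) [OF sigma_hom] K_closed smult_smult_assoc mult.commute)
  assume w: "w \<in> isotypic"
  show "v + w \<in> isotypic"
    using v w smult_add_distrib_vec [of v n w]
    by (auto simp: isotypic_def cvec_homD(2) [OF sigma_hom] K_closed)
qed (auto simp: isotypic_def cvec_homD(4) [OF sigma_hom] K_closed)

lemma proj_hom: "proj \<in> module_hom complex_field (cvec n) (cvec n)"
proof -
  have "proj (v + w) = proj v + proj w" if "v \<in> carrier_vec n" "w \<in> carrier_vec n" for v w
  proof (intro eq_vecI)
    fix r assume "r < dim_vec (proj v + proj w)"
    then have r: "r < n" by (simp add: proj_def vec_sum_def)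
    have "\<sigma> k (v + w) $ r = \<sigma> k v $ r + \<sigma> k w $ r" if "k \<in> K" for k
      using that r \<open>v \<in> _\<close> \<open>w \<in> _\<close> sigma_closed [of k w] K_closed [of k]
      by (simp add: cvec_homD(2) [OF sigma_hom])
    then show "proj (v + w) $ r = (proj v + proj w) $ r"
      using r by (simp add: proj_def vec_sum_def algebra_simps sum.distrib)
  qed (simp add: proj_def vec_sum_def)
  moreover have "proj (c \<cdot>\<^sub>v v) = c \<cdot>\<^sub>v proj v" if "v \<in> carrier_vec n" for c v
  proof (intro eq_vecI)
    fix r assume "r < dim_vec (c \<cdot>\<^sub>v proj v)"
    then have r: "r < n" by (simp add: proj_def vec_sum_def)
    have "\<sigma> k (c \<cdot>\<^sub>v v) $ r = c * \<sigma> k v $ r" if "k \<in> K" for k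
      using that r \<open>v \<in> _\<close> sigma_closed [of k v] K_closed [of k]
      by (simp add: cvec_homD(3) [OF sigma_hom])
    then show "proj (c \<cdot>\<^sub>v v) $ r = (c \<cdot>\<^sub>v proj v) $ r"
      using r by (simp add: proj_def vec_sum_def algebra_simps sum_distrib_left)
  qed (simp add: proj_def vec_sum_def)
  ultimately show ?thesis
    by (auto simp: module_hom_def module_vec_simps proj_def)
qed

text \<open>Substituting \<open>l \<otimes> k\<close> for \<open>l\<close> in the sum over
  \<open>K\<close> pulls out the factor \<open>\<chi> k\<close>.\<close>

lemma proj_sigma:
  assumes k: "k \<in> K" and v: "v \<in> carrier_vec n"
  shows "proj (\<sigma> k v) = \<chi> k \<cdot>\<^sub>v proj v"
proof -
  have "\<chi> (inv l) = \<chi> k * \<chi> (inv (l \<otimes> k))" if l: "l \<in> K" for l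
  proof -
    have "inv l = k \<otimes> inv (l \<otimes> k)"
      using k l by (simp add: inv_mult_group K_closed m_assoc [symmetric])
    then show ?thesis using chi_mult k l by (simp add: K_mult K_inv)
  qed
  then have "proj (\<sigma> k v) = vec_sum n K (\<lambda>l. \<chi> k * \<chi> (inv (l \<otimes> k))) (\<lambda>l. \<sigma> (l \<otimes> k) v)"
    unfolding proj_def using k v by (intro vec_sum_cong) (auto simp: sigma_mult K_closed)
  also have "\<dots> = vec_sum n K (\<lambda>l. \<chi> k * \<chi> (inv l)) (\<lambda>l. \<sigma> l v)"
    by (rule vec_sum_reindex [OF bij_betw_right_mult [OF k], symmetric])
  also have "\<dots> = \<chi> k \<cdot>\<^sub>v proj v"
    unfolding proj_def using v by (intro vec_sum_smult [symmetric]) (auto simp: sigma_closed K_closed)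
  finally show ?thesis .
qed

text \<open>The same substitution from the left, with \<open>k \<otimes> l\<close> for
  \<open>l\<close>.\<close>

lemma proj_in_isotypic:
  assumes v: "v \<in> carrier_vec n"
  shows "proj v \<in> isotypic"
  unfolding isotypic_def
proof (intro CollectI conjI ballI)
  show "proj v \<in> carrier_vec n" by (simp add: proj_def)
  fix k assume k: "k \<in> K"
  have "\<chi> (inv l) = \<chi> k * \<chi> (inv (k \<otimes> l))" if l: "l \<in> K" for l
  proof -
    have "inv l = inv (k \<otimes> l) \<otimes> k"
      using k l by (simp add: inv_mult_group K_closed m_assoc)
    then show ?thesis using chi_mult k l by (simp add: K_mult K_inv)
  qed
  then have "\<sigma> k (proj v) = vec_sum n K (\<lambda>l. \<chi> k * \<chi> (inv (k \<otimes> l))) (\<lambda>l. \<sigma> (k \<otimes> l) v)"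
    unfolding proj_def using k v
    by (subst hom_vec_sum [OF sigma_hom])
       (auto simp: sigma_mult sigma_closed K_closed finite_K intro!: vec_sum_cong)
  also have "\<dots> = vec_sum n K (\<lambda>l. \<chi> k * \<chi> (inv l)) (\<lambda>l. \<sigma> l v)"
    by (rule vec_sum_reindex [OF bij_betw_left_mult [OF k], symmetric])
  also have "\<dots> = \<chi> k \<cdot>\<^sub>v proj v"
    unfolding proj_def using v by (intro vec_sum_smult [symmetric]) (auto simp: sigma_closed K_closed)
  finally show "\<sigma> k (proj v) = \<chi> k \<cdot>\<^sub>v proj v" .
qed

text \<open>Write \<open>\<tau> g\<close> as \<open>k \<otimes> g \<otimes> l\<close>. The factor
  \<open>l\<close> acts on the isotypic vector by \<open>\<chi> l\<close>, \<open>proj\<close> turns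
  \<open>k\<close> into \<open>\<chi> k\<close>, and the two scalars cancel.\<close>

lemma proj_sigma_tau:
  assumes g: "g \<in> carrier G" and v: "v \<in> isotypic"
  shows "proj (\<sigma> (\<tau> g) v) = proj (\<sigma> g v)"
proof -
  obtain k l where kl: "k \<in> K" "l \<in> K" "\<tau> g = k \<otimes> g \<otimes> l" "\<chi> k * \<chi> l = 1"
    using tau_double_coset [OF g] by blast
  have vc: "v \<in> carrier_vec n" using v by (simp add: isotypic_def)
  have gv: "\<sigma> g v \<in> carrier_vec n" using g vc by (rule sigma_closed)
  have "\<sigma> (\<tau> g) v = \<sigma> k (\<sigma> g (\<sigma> l v))"
    using kl g vc by (simp add: sigma_mult K_closed sigma_closed)
  also have "\<dots> = \<sigma> k (\<chi> l \<cdot>\<^sub>v \<sigma> g v)"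
    using v kl g vc by (simp add: isotypic_def cvec_homD(3) [OF sigma_hom])
  finally have "proj (\<sigma> (\<tau> g) v) = \<chi> k \<cdot>\<^sub>v (\<chi> l \<cdot>\<^sub>v proj (\<sigma> g v))"
    using kl gv by (simp add: proj_sigma cvec_homD(3) [OF proj_hom])
  then show ?thesis using kl(4) by (simp add: smult_smult_assoc)
qed

section \<open>Hecke operators on the isotypic subspace\<close>

lemma hecke_hom:
  assumes g: "g \<in> carrier G"
  shows "(\<lambda>v. proj (\<sigma> g v)) \<in> module_hom complex_field (cvec n) (cvec n)"
  using cvec_homD [OF proj_hom] cvec_homD [OF sigma_hom [OF g]]
  by (auto simp: module_hom_def module_vec_simps)

text \<open>Expanding the inner projection gives the product of the Hecke algebra: a weighted sum
  over the elements \<open>g \<otimes> k \<otimes> h\<close>, to which \<tau> can be applied one by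
  one.\<close>

lemma hecke_mult:
  assumes "g \<in> carrier G" "h \<in> carrier G" "v \<in> carrier_vec n"
  shows "proj (\<sigma> g (proj (\<sigma> h v))) =
           vec_sum n K (\<lambda>k. \<chi> (inv k)) (\<lambda>k. proj (\<sigma> (g \<otimes> k \<otimes> h) v))"
proof -
  have "proj (\<sigma> g (proj (\<sigma> h v))) =
          vec_sum n K (\<lambda>k. \<chi> (inv k)) (\<lambda>k. proj (\<sigma> g (\<sigma> k (\<sigma> h v))))"
    unfolding proj_def [of "\<sigma> h v"] using assms
    by (intro hom_vec_sum [OF hecke_hom]) (auto simp: finite_K sigma_closed K_closed)
  then show ?thesis
    using assms by (simp add: sigma_mult sigma_closed K_closed m_assoc cong: vec_sum_cong)
qed

text \<open>Gelfand's trick: \<open>\<tau>\<close> reverses products but leaves \<open>proj (\<sigma> g v)\<close> unchanged.\<close>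

lemma hecke_commute:
  assumes g: "g \<in> carrier G" and h: "h \<in> carrier G" and v: "v \<in> isotypic"
  shows "proj (\<sigma> g (proj (\<sigma> h v))) = proj (\<sigma> h (proj (\<sigma> g v)))"
proof -
  have vc: "v \<in> carrier_vec n" using v by (simp add: isotypic_def)
  have "proj (\<sigma> (g \<otimes> k \<otimes> h) v) = proj (\<sigma> (\<tau> h \<otimes> k \<otimes> \<tau> g) v)" if k: "k \<in> K" for k
  proof -
    have "\<tau> (g \<otimes> k \<otimes> h) = \<tau> h \<otimes> k \<otimes> \<tau> g"
      using g h k by (simp add: tau_mult tau_K K_closed tau_closed m_assoc)
    then show ?thesis using proj_sigma_tau [of "g \<otimes> k \<otimes> h" v] g h k v by (simp add: K_closed)
  qed
  then have "proj (\<sigma> g (proj (\<sigma> h v))) = proj (\<sigma> (\<tau> h) (proj (\<sigma> (\<tau> g) v)))"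
    using g h vc by (simp add: hecke_mult tau_closed cong: vec_sum_cong)
  \<comment> \<open>After \<tau> is removed from the inner operator, the inner vector is isotypic,
    so it can be removed from the outer one too.\<close>
  also have "\<dots> = proj (\<sigma> h (proj (\<sigma> g v)))"
    using g h v vc by (simp add: proj_sigma_tau proj_in_isotypic sigma_closed)
  finally show ?thesis .
qed

text \<open>These functionals form Hom_K(\<sigma>, \<chi>), which Frobenius reciprocity matches with
  the intertwiners from \<sigma> to the induced representation.\<close>

definition equivariant_functional :: "(complex vec \<Rightarrow> complex) \<Rightarrow> bool" where
  "equivariant_functional l \<longleftrightarrow>
     (\<forall>v\<in>carrier_vec n. \<forall>w\<in>carrier_vec n. l (v + w) = l v + l w) \<and>
     (\<forall>c. \<forall>v\<in>carrier_vec n. l (c \<cdot>\<^sub>v v) = c * l v) \<and>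
     (\<forall>k\<in>K. \<forall>v\<in>carrier_vec n. l (\<sigma> k v) = \<chi> k * l v)"

text \<open>Each summand contributes \<open>\<chi> (inv k) * \<chi> k * l v\<close>, which is
  \<open>l v\<close>. So an equivariant functional is determined by its values on projected
  vectors.\<close>

lemma equivariant_functional_proj:
  assumes l: "equivariant_functional l" and v: "v \<in> carrier_vec n"
  shows "l (proj v) = of_nat (card K) * l v"
proof -
  have "l (proj v) = (\<Sum>k\<in>K. \<chi> (inv k) * l (\<sigma> k v))"
    unfolding proj_def using l v
    by (intro functional_vec_sum) (auto simp: equivariant_functional_def finite_K sigma_closed K_closed)
  also have "\<dots> = (\<Sum>k\<in>K. l v)"
    using l v chi_inv_mult by (intro sum.cong) (auto simp: equivariant_functional_def mult.assoc [symmetric])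
  finally show ?thesis by simp
qed

text \<open>Take for \<open>u\<close> a common isotypic eigenvector of the Hecke operators. Applying
  \<open>l\<close> to the eigenvalue equation of \<open>proj (\<sigma> g u)\<close> expresses
  \<open>l (\<sigma> g u)\<close> through \<open>l u\<close>. The scalar is the eigenvalue over
  \<open>card K\<close>, hence it can be chosen before \<open>l\<close>.\<close>

lemma exists_separating_vector:
  assumes l: "equivariant_functional l" and v: "v \<in> carrier_vec n" "l v \<noteq> 0"
  shows "\<exists>u. u \<in> carrier_vec n \<and> u \<noteq> 0\<^sub>v n \<and>
           (\<forall>g\<in>carrier G. \<exists>c. \<forall>l. equivariant_functional l \<longrightarrow> l (\<sigma> g u) = c * l u)"
proof -
  \<comment> \<open>The given functional ensures that the isotypic part is nonzero: it kills the
    zero vector but not \<open>proj v\<close>.\<close>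
  have "l (0\<^sub>v n) = 0 * l (0\<^sub>v n)"
    using l unfolding equivariant_functional_def by (metis smult_zero_cvec zero_carrier_vec)
  moreover have "l (proj v) \<noteq> 0"
    using v card_K by (simp add: equivariant_functional_proj [OF l])
  ultimately have "proj v \<noteq> 0\<^sub>v n" by auto
  then obtain u where u: "u \<in> isotypic" "u \<noteq> 0\<^sub>v n"
    and eig: "\<And>g. g \<in> carrier G \<Longrightarrow> \<exists>c. proj (\<sigma> g u) = c \<cdot>\<^sub>v u"
    using exists_common_eigenvector [where A = "\<lambda>g v. proj (\<sigma> g v)", OF finite_G hecke_hom submodule_isotypic]
      proj_in_isotypic hecke_commute v sigma_closed
    by (smt (verit, best) isotypic_def mem_Collect_eq)
  have uc: "u \<in> carrier_vec n" using u by (simp add: isotypic_def)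
  have "\<exists>c. \<forall>l. equivariant_functional l \<longrightarrow> l (\<sigma> g u) = c * l u" if g: "g \<in> carrier G" for g
  proof -
    obtain c where c: "proj (\<sigma> g u) = c \<cdot>\<^sub>v u" using eig [OF g] by blast
    have "l (\<sigma> g u) = c / of_nat (card K) * l u" if l: "equivariant_functional l" for l
    proof -
      have "of_nat (card K) * l (\<sigma> g u) = l (c \<cdot>\<^sub>v u)"
        using equivariant_functional_proj [OF l, of "\<sigma> g u"] c g uc by (simp add: sigma_closed)
      also have "\<dots> = c * l u" using l uc by (simp add: equivariant_functional_def)
      finally show ?thesis using card_K by (simp add: field_simps)
    qed
    then show ?thesis by blast
  qed
  then show ?thesis using uc u(2) by blast
qed

end

section \<open>Multiplicities in the induced representation\<close>

lemma linear_map_module_hom: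
  "linear_map R U V T \<Longrightarrow> T \<in> module_hom R U V"
  by (simp add: linear_map_def mod_hom_def mod_hom_axioms_def)

context twisted_gelfand_pair
begin

abbreviation Ind :: "(complex, 'a \<Rightarrow> complex) module" where
  "Ind \<equiv> induced_space G K complex_line (one_dim_action \<chi>)"

lemma Ind_simps:
  "\<zero>\<^bsub>Ind\<^esub> = (\<lambda>x\<in>carrier G. 0)"
  "F \<oplus>\<^bsub>Ind\<^esub> F' = (\<lambda>x\<in>carrier G. F x + F' x)"
  "c \<odot>\<^bsub>Ind\<^esub> F = (\<lambda>x\<in>carrier G. c * F x)"
  by (simp_all add: induced_space_def complex_line_def)

lemma Ind_carrierD:
  assumes "F \<in> carrier Ind"
  shows "F \<in> extensional (carrier G)"
    and "g \<in> carrier G \<Longrightarrow> k \<in> K \<Longrightarrow> F (g \<otimes> k) = \<chi> (inv k) * F g"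
  using assms by (auto simp: induced_space_def complex_line_def one_dim_action_def PiE_def)

lemma Ind_eq_zeroI:
  assumes "F \<in> carrier Ind" "\<And>x. x \<in> carrier G \<Longrightarrow> F x = 0"
  shows "F = \<zero>\<^bsub>Ind\<^esub>"
  unfolding Ind_simps using Ind_carrierD(1) [OF assms(1)] assms(2)
  by (intro extensionalityI [of _ "carrier G"]) auto

lemma embedding_properties:
  assumes W: "invariant_subspace G Ind (induced_action G) W"
    and T: "linear_map complex_field (cvec n) (Ind\<lparr>carrier := W\<rparr>) T"
    and act: "\<forall>g\<in>carrier G. \<forall>v\<in>carrier_vec n. T (\<sigma> g v) = induced_action G g (T v)"
  shows "v \<in> carrier_vec n \<Longrightarrow> T v \<in> W"
    and "v \<in> carrier_vec n \<Longrightarrow> T v \<in> carrier Ind"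
    and "v \<in> carrier_vec n \<Longrightarrow> w \<in> carrier_vec n \<Longrightarrow> x \<in> carrier G \<Longrightarrow> T (v + w) x = T v x + T w x"
    and "v \<in> carrier_vec n \<Longrightarrow> x \<in> carrier G \<Longrightarrow> T (c \<cdot>\<^sub>v v) x = c * T v x"
    and "v \<in> carrier_vec n \<Longrightarrow> g \<in> carrier G \<Longrightarrow> x \<in> carrier G \<Longrightarrow> T (\<sigma> g v) x = T v (inv g \<otimes> x)"
proof -
  have WI: "W \<subseteq> carrier Ind"
    using W by (auto simp: invariant_subspace_def subspace_def submodule_def)
  have hom: "T \<in> module_hom complex_field (cvec n) (Ind\<lparr>carrier := W\<rparr>)"
    using T by (rule linear_map_module_hom)
  show 1: "v \<in> carrier_vec n \<Longrightarrow> T v \<in> W" for v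
    using hom by (auto simp: module_hom_def module_vec_simps)
  show "v \<in> carrier_vec n \<Longrightarrow> T v \<in> carrier Ind" using 1 WI by blast
  show "v \<in> carrier_vec n \<Longrightarrow> w \<in> carrier_vec n \<Longrightarrow> x \<in> carrier G \<Longrightarrow> T (v + w) x = T v x + T w x"
    using hom by (auto simp: module_hom_def module_vec_simps Ind_simps)
  show "v \<in> carrier_vec n \<Longrightarrow> x \<in> carrier G \<Longrightarrow> T (c \<cdot>\<^sub>v v) x = c * T v x"
    using hom by (auto simp: module_hom_def module_vec_simps Ind_simps)
  show "v \<in> carrier_vec n \<Longrightarrow> g \<in> carrier G \<Longrightarrow> x \<in> carrier G \<Longrightarrow> T (\<sigma> g v) x = T v (inv g \<otimes> x)"
    by (simp add: act induced_action_def)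
qed

text \<open>Choose \<open>p\<close> and \<open>r\<close> so that the combined functional vanishes at
  the eigenvector \<open>u\<close>. It then vanishes on the whole orbit of \<open>u\<close>, so
  \<open>u\<close> lies in the kernel of the combined intertwiner. This kernel is invariant, hence
  everything by irreducibility.\<close>

lemma embeddings_dependent:
  assumes irr: "irreducible_representation G (cvec n) \<sigma>"
    and W: "\<And>j. j \<in> {0,1} \<Longrightarrow> invariant_subspace G Ind (induced_action G) (W j)"
    and T: "\<And>j. j \<in> {0,1} \<Longrightarrow> linear_map complex_field (cvec n) (Ind\<lparr>carrier := W j\<rparr>) (T j)"
    and act: "\<And>j. j \<in> {0,1} \<Longrightarrow>
                \<forall>g\<in>carrier G. \<forall>v\<in>carrier_vec n. T j (\<sigma> g v) = induced_action G g (T j v)"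
    and nz: "v0 \<in> carrier_vec n" "T (0::nat) v0 \<noteq> \<zero>\<^bsub>Ind\<^esub>"
  shows "\<exists>p r. (p \<noteq> 0 \<or> r \<noteq> 0) \<and>
           (\<forall>v\<in>carrier_vec n. \<forall>x\<in>carrier G. p * T 0 v x + r * T 1 v x = 0)"
proof -
  have rep: "representation G (cvec n) \<sigma>"
    using irr by (simp add: irreducible_representation_def)
  interpret twisted_gelfand_rep G K \<chi> \<tau> n \<sigma>
  proof
    show "\<sigma> g \<in> module_hom complex_field (cvec n) (cvec n)" if "g \<in> carrier G" for g
      using rep that by (auto simp: representation_def intro: linear_map_module_hom)
  qed (use rep in \<open>auto simp: representation_def module_vec_simps\<close>)
  note Tp = embedding_properties [OF W T act]
  define l where "l j v = T j v \<one>" for j v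
  \<comment> \<open>Frobenius reciprocity: translating \<open>x\<close> to the identity recovers
    \<open>T j\<close> from the functional \<open>l j\<close>.\<close>
  have T_l: "T j v x = l j (\<sigma> (inv x) v)" if "j \<in> {0,1}" "v \<in> carrier_vec n" "x \<in> carrier G" for j v x
    using that Tp(5) [of j v "inv x" \<one>] by (simp add: l_def)
  have l: "equivariant_functional (l j)" if j: "j \<in> {0,1}" for j
    unfolding equivariant_functional_def
  proof (intro conjI ballI allI)
    fix k and v :: "complex vec" assume k: "k \<in> K" and v: "v \<in> carrier_vec n"
    have "l j (\<sigma> k v) = T j v (\<one> \<otimes> inv k)"
      using Tp(5) [OF j j j v, of k \<one>] j k by (simp add: l_def K_closed)
    \<comment> \<open>The covariance of functions in \<open>Ind\<close> is applied to
      \<open>inv k\<close>, so the inverse in its definition disappears.\<close>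
    also have "\<dots> = \<chi> k * l j v"
      using Ind_carrierD(2) [OF Tp(2) [OF j j j v], of \<one> "inv k"] j k by (simp add: l_def K_inv K_closed)
    finally show "l j (\<sigma> k v) = \<chi> k * l j v" .
  qed (use j Tp(3,4) in \<open>auto simp: l_def\<close>)
  \<comment> \<open>A point \<open>x0\<close> where \<open>T 0 v0\<close> is nonzero yields the
    vector \<open>\<sigma> (inv x0) v0\<close>, on which \<open>l 0\<close> is nonzero.\<close>
  have "\<exists>x\<in>carrier G. T 0 v0 x \<noteq> 0"
  proof (rule ccontr)
    assume *: "\<not> ?thesis"
    have "T 0 v0 = \<zero>\<^bsub>Ind\<^esub>"
      by (rule Ind_eq_zeroI) (use * Tp(2) [of 0 v0] nz(1) in auto)
    with nz(2) show False ..
  qed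
  then obtain x0 where x0: "x0 \<in> carrier G" "T 0 v0 x0 \<noteq> 0" by blast
  obtain u where u: "u \<in> carrier_vec n" "u \<noteq> 0\<^sub>v n"
    and sep: "\<And>g. g \<in> carrier G \<Longrightarrow> \<exists>c. \<forall>l. equivariant_functional l \<longrightarrow> l (\<sigma> g u) = c * l u"
    using exists_separating_vector [OF l, of 0 "\<sigma> (inv x0) v0"] T_l [of 0 v0 x0] x0 nz(1)
    by (auto simp: sigma_closed)
  \<comment> \<open>The pair \<open>(l 1 u, - l 0 u)\<close> solves the equation but may be zero
    when \<open>l 0 u = 0\<close>; then (1, 0) serves.\<close>
  obtain p r where pr: "p \<noteq> 0 \<or> r \<noteq> 0" "p * l 0 u + r * l 1 u = 0"
  proof (cases "l 0 u = 0")
    case True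
    then show ?thesis by (intro that [of 1 0]) auto
  next
    case False
    then show ?thesis by (intro that [of "l 1 u" "- l 0 u"]) auto
  qed
  \<comment> \<open>The kernel of \<open>p T 0 + r T 1\<close>, stated pointwise since the two
    embeddings have different target records.\<close>
  define Z where "Z = {v \<in> carrier_vec n. \<forall>x\<in>carrier G. p * T 0 v x + r * T 1 v x = 0}"
  have Z_sub: "submodule complex_field Z (cvec n)"
  proof (rule cvec_submoduleI)
    have "T j (0\<^sub>v n) x = 0" if "j \<in> {0,1}" "x \<in> carrier G" for j x
      using Tp(4) [of j "0\<^sub>v n" x 0] that by (simp add: smult_zero_cvec)
    then show "0\<^sub>v n \<in> Z" by (simp add: Z_def)
    show "v + w \<in> Z" if "v \<in> Z" "w \<in> Z" for v w
    proof -
      have vw: "v \<in> carrier_vec n" "w \<in> carrier_vec n" using that by (auto simp: Z_def)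
      have "p * T 0 (v + w) x + r * T 1 (v + w) x =
              (p * T 0 v x + r * T 1 v x) + (p * T 0 w x + r * T 1 w x)" if "x \<in> carrier G" for x
        using vw that by (simp add: Tp(3) algebra_simps)
      then show ?thesis using that by (simp add: Z_def)
    qed
    show "c \<cdot>\<^sub>v v \<in> Z" if "v \<in> Z" for c v
    proof -
      have vc: "v \<in> carrier_vec n" using that by (simp add: Z_def)
      have "p * T 0 (c \<cdot>\<^sub>v v) x + r * T 1 (c \<cdot>\<^sub>v v) x = c * (p * T 0 v x + r * T 1 v x)"
        if "x \<in> carrier G" for x
        using vc that by (simp add: Tp(4) algebra_simps)
      then show ?thesis using that by (simp add: Z_def)
    qed
  qed (auto simp: Z_def)
  have "invariant_subspace G (cvec n) \<sigma> Z"
    unfolding invariant_subspace_def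
  proof (intro conjI ballI)
    show "subspace complex_field Z (cvec n)"
      using Z_sub rep by (simp add: subspace_def representation_def)
    show "\<sigma> g v \<in> Z" if "g \<in> carrier G" "v \<in> Z" for g v
      using that by (auto simp: Z_def Tp(5) sigma_closed)
  qed
  moreover have "u \<in> Z"
  proof -
    have "p * T 0 u x + r * T 1 u x = 0" if x: "x \<in> carrier G" for x
    proof -
      \<comment> \<open>One scalar serves both \<open>l 0\<close> and \<open>l 1\<close>.\<close>
      obtain c where c: "\<And>l. equivariant_functional l \<Longrightarrow> l (\<sigma> (inv x) u) = c * l u"
        using sep [of "inv x"] x by auto
      have "p * T 0 u x + r * T 1 u x = c * (p * l 0 u + r * l 1 u)"
        using x u by (simp add: T_l c l algebra_simps)
      then show ?thesis using pr(2) by simp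
    qed
    then show ?thesis using u by (simp add: Z_def)
  qed
  ultimately have "Z = carrier_vec n"
    using irr u(2) by (auto simp: irreducible_representation_def module_vec_simps)
  then show ?thesis using pr(1) by (auto simp: Z_def)
qed

text \<open>Two copies in direct sum would give two embeddings whose values at a nonzero
  \<open>v\<close> are nonzero by injectivity. A nontrivial linear relation between these values
  contradicts directness.\<close>

theorem multiplicity_free_induced: "multiplicity_free G Ind (induced_action G)"
  unfolding multiplicity_free_def
proof (intro allI impI)
  fix n \<sigma> m
  assume irr: "irreducible_representation G (cvec n) \<sigma>"
    and "contains_copies G Ind (induced_action G) (cvec n) \<sigma> m"
  then obtain W where
    copies: "\<forall>j<m. invariant_subspace G Ind (induced_action G) (W j) \<and>
          equivalent_representations G (cvec n) \<sigma> (Ind\<lparr>carrier := W j\<rparr>) (induced_action G)"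
    and direct: "\<forall>w. (\<forall>j<m. w j \<in> W j) \<and> (\<Oplus>\<^bsub>Ind\<^esub>j\<in>{..<m}. w j) = \<zero>\<^bsub>Ind\<^esub> \<longrightarrow>
          (\<forall>j<m. w j = \<zero>\<^bsub>Ind\<^esub>)"
    unfolding contains_copies_def by (elim exE conjE)
  have inv: "invariant_subspace G Ind (induced_action G) (W j)"
    and equiv: "equivalent_representations G (cvec n) \<sigma> (Ind\<lparr>carrier := W j\<rparr>) (induced_action G)"
    if "j < m" for j
    using copies that by auto
  show "m \<le> 1"
  proof (rule ccontr)
    assume "\<not> m \<le> 1"
    then have lt: "j < m" if "j \<in> {0,1}" for j using that by auto
    have "\<exists>T. \<forall>j\<in>{0,1}. linear_map complex_field (cvec n) (Ind\<lparr>carrier := W j\<rparr>) (T j) \<and>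
            bij_betw (T j) (carrier_vec n) (W j) \<and>
            (\<forall>g\<in>carrier G. \<forall>u\<in>carrier_vec n. T j (\<sigma> g u) = induced_action G g (T j u))"
      using equiv [OF lt] unfolding equivalent_representations_def
      by (intro bchoice) (auto simp: module_vec_simps)
    then obtain T where
      T: "\<And>j. j \<in> {0,1} \<Longrightarrow> linear_map complex_field (cvec n) (Ind\<lparr>carrier := W j\<rparr>) (T j)"
      and bij: "\<And>j. j \<in> {0,1} \<Longrightarrow> bij_betw (T j) (carrier_vec n) (W j)"
      and act: "\<And>j. j \<in> {0,1} \<Longrightarrow>
                  \<forall>g\<in>carrier G. \<forall>v\<in>carrier_vec n. T j (\<sigma> g v) = induced_action G g (T j v)"
      by blast
    note Tp = embedding_properties [OF inv [OF lt] T act]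
    have sub: "submodule complex_field (W j) Ind" if "j < m" for j
      using inv [OF that] by (simp add: invariant_subspace_def subspace_def)
    \<comment> \<open>The predicate \<open>submodule\<close> includes the module axioms of the
      ambient space, so they can be read off from \<open>W 0\<close>.\<close>
    have Ind_monoid: "abelian_monoid Ind"
      using sub [OF lt, of 0]
      by (auto simp: submodule_def intro: abelian_group.axioms module.axioms)
    have "carrier_vec n \<noteq> {0\<^sub>v n :: complex vec}"
      using irr by (simp add: irreducible_representation_def module_vec_simps)
    moreover have "carrier_vec n = {0\<^sub>v n :: complex vec}" if "\<And>v::complex vec. v \<in> carrier_vec n \<Longrightarrow> v = 0\<^sub>v n"
      using that by auto
    ultimately obtain v :: "complex vec" where v: "v \<in> carrier_vec n" "v \<noteq> 0\<^sub>v n"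
      by metis
    have Tv: "T j v \<noteq> \<zero>\<^bsub>Ind\<^esub>" if j: "j \<in> {0,1}" for j
    proof
      assume 0: "T j v = \<zero>\<^bsub>Ind\<^esub>"
      have "T j (0\<^sub>v n) = \<zero>\<^bsub>Ind\<^esub>"
      proof (rule Ind_eq_zeroI)
        show "T j (0\<^sub>v n) \<in> carrier Ind" by (rule Tp(2) [OF j j j]) simp
        show "T j (0\<^sub>v n) x = 0" if "x \<in> carrier G" for x
          using Tp(4) [OF j j j zero_carrier_vec that, of 0] by (simp add: smult_zero_cvec)
      qed
      with 0 have "T j v = T j (0\<^sub>v n)" by simp
      then show False
        using bij_betw_imp_inj_on [OF bij [OF j]] v by (auto dest: inj_onD)
    qed
    obtain p r where pr: "p \<noteq> 0 \<or> r \<noteq> 0"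
      and dep: "\<And>x. x \<in> carrier G \<Longrightarrow> p * T 0 v x + r * T 1 v x = 0"
      using embeddings_dependent [of n \<sigma> W T v, OF irr inv [OF lt] T act v(1) Tv] v(1) by auto
    define c where "c j = (if j = 0 then p else if j = 1 then r else 0)" for j :: nat
    \<comment> \<open>The relation is padded with zeros, because directness concerns families
      indexed by all \<open>j < m\<close>.\<close>
    define w where "w j = (if j \<in> {0,1} then c j \<odot>\<^bsub>Ind\<^esub> T j v else \<zero>\<^bsub>Ind\<^esub>)" for j
    have wW: "w j \<in> W j" if "j < m" for j
    proof (cases "j \<in> {0,1}")
      case True
      then show ?thesis
        unfolding w_def using submodule.smult_closed [OF sub [OF that], of "c j" "T j v"] Tp(1) [OF True True True v(1)]
        by simp
    next
      case False
      then show ?thesis unfolding w_def using submodule.zero_closed [OF sub [OF that]] by simp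
    qed
    have wV: "w j \<in> carrier Ind" if "j < m" for j
      using wW [OF that] submodule.subset [OF sub [OF that]] by blast
    have split: "{..<m} = insert 0 (insert 1 {2..<m})" using lt by auto
    have "(\<Oplus>\<^bsub>Ind\<^esub>j\<in>{2..<m}. w j) = (\<Oplus>\<^bsub>Ind\<^esub>j\<in>{2..<m}. \<zero>\<^bsub>Ind\<^esub>)"
      by (rule abelian_monoid.finsum_cong' [OF Ind_monoid]) (auto simp: w_def abelian_monoid.zero_closed [OF Ind_monoid])
    then have "(\<Oplus>\<^bsub>Ind\<^esub>j\<in>{..<m}. w j) = w 0 \<oplus>\<^bsub>Ind\<^esub> w 1"
      unfolding split using wV lt 
      by (simp add: abelian_monoid.finsum_insert [OF Ind_monoid] abelian_monoid.finsum_zero [OF Ind_monoid]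
          abelian_monoid.r_zero [OF Ind_monoid] abelian_monoid.zero_closed [OF Ind_monoid] Pi_iff)
    also have "\<dots> = \<zero>\<^bsub>Ind\<^esub>"
      using dep by (auto simp: w_def c_def Ind_simps)
    finally have w0: "w j = \<zero>\<^bsub>Ind\<^esub>" if "j \<in> {0,1}" for j
      using direct wW lt [OF that] by blast
    have "c j = 0" if j: "j \<in> {0,1}" for j
    proof (rule ccontr)
      assume "c j \<noteq> 0"
      have "T j v = \<zero>\<^bsub>Ind\<^esub>"
      proof (rule Ind_eq_zeroI)
        show "T j v \<in> carrier Ind" by (rule Tp(2) [OF j j j v(1)])
        show "T j v x = 0" if "x \<in> carrier G" for x
          using fun_cong [OF w0 [OF j], of x] j that \<open>c j \<noteq> 0\<close> by (simp add: w_def Ind_simps)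
      qed
      with Tv [OF j] show False by simp
    qed
    from this [of 0] this [of 1] pr show False by (auto simp: c_def)
  qed
qed

end

section \<open>The Cartan subgroup\<close>

abbreviation mat2 :: "'f::field \<Rightarrow> 'f \<Rightarrow> 'f \<Rightarrow> 'f \<Rightarrow> 'f mat" where
  "mat2 a b c d \<equiv> mat_of_rows_list 2 [[a, b], [c, d]]"

lemma mat2_carrier [simp]: "mat2 a b c d \<in> carrier_mat 2 2"
  by (rule carrier_matI) (simp_all add: mat_of_rows_list_def)

lemma mat2_index [simp]:
  "mat2 a b c d $$ (0, 0) = a" "mat2 a b c d $$ (0, 1) = b" "mat2 a b c d $$ (0, Suc 0) = b"
  "mat2 a b c d $$ (1, 0) = c" "mat2 a b c d $$ (1, 1) = d"
  "mat2 a b c d $$ (Suc 0, 0) = c" "mat2 a b c d $$ (Suc 0, Suc 0) = d"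
  by (simp_all add: mat_of_rows_list_def)

lemma mat2_eqI:
  assumes "A \<in> carrier_mat 2 2" "B \<in> carrier_mat 2 2"
    and "A $$ (0, 0) = B $$ (0, 0)" "A $$ (0, 1) = B $$ (0, 1)"
    and "A $$ (1, 0) = B $$ (1, 0)" "A $$ (1, 1) = B $$ (1, 1)"
  shows "A = B"
proof (intro eq_matI)
  fix i j assume "i < dim_row B" "j < dim_col B"
  then have "(i = 0 \<or> i = 1) \<and> (j = 0 \<or> j = 1)" using assms(2) by auto
  then show "A $$ (i, j) = B $$ (i, j)" using assms by auto
qed (use assms in auto)

lemma mat2_cases:
  assumes "A \<in> carrier_mat 2 2"
  obtains a b c d where "A = mat2 a b c d"
proof -
  have "A = mat2 (A $$ (0,0)) (A $$ (0,1)) (A $$ (1,0)) (A $$ (1,1))"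
    using assms by (intro mat2_eqI) auto
  then show ?thesis by (rule that)
qed

lemma mat2_mult:
  "mat2 a b c d * mat2 a' b' c' d' =
     mat2 (a * a' + b * c') (a * b' + b * d') (c * a' + d * c') (c * b' + d * d')"
  by (intro mat2_eqI) (auto simp: mat_of_rows_list_def scalar_prod_def numeral_2_eq_2)

lemma mat2_one: "1\<^sub>m 2 = mat2 1 0 0 1"
  by (intro mat2_eqI) auto

lemma mat2_eq_iff: "mat2 a b c d = mat2 a' b' c' d' \<longleftrightarrow> a = a' \<and> b = b' \<and> c = c' \<and> d = d'"
  by (metis mat2_index(1,2,4,5))

lemma GL_simps:
  "carrier (general_linear_group n) = Units (ring_mat TYPE('f::field) n ())"
  "A \<otimes>\<^bsub>general_linear_group n\<^esub> B = (A * B :: 'f mat)"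
  "\<one>\<^bsub>general_linear_group n\<^esub> = (1\<^sub>m n :: 'f mat)"
  by (simp_all add: general_linear_group_def units_of_def ring_mat_simps)

lemma GL_closed: "A \<in> carrier (general_linear_group n) \<Longrightarrow> A \<in> carrier_mat n n"
  by (simp add: GL_simps Units_def ring_mat_simps)

lemma GL_I:
  assumes "A \<in> carrier_mat n n" "B \<in> carrier_mat n n" "A * B = 1\<^sub>m n" "B * A = 1\<^sub>m n"
  shows "A \<in> carrier (general_linear_group n)"
  using assms by (auto simp: GL_simps Units_def ring_mat_simps)

lemma GL_E:
  assumes "A \<in> carrier (general_linear_group n)"
  obtains B where "B \<in> carrier_mat n n" "A * B = 1\<^sub>m n" "B * A = 1\<^sub>m n"
  using assms by (auto simp: GL_simps Units_def ring_mat_simps)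

lemma group_GL: "group (general_linear_group n :: 'f::field mat monoid)"
proof -
  interpret ring "ring_mat TYPE('f) n ()" by (rule ring_mat)
  show ?thesis unfolding general_linear_group_def by (rule units_group)
qed

lemma finite_GL2: "finite (carrier (general_linear_group 2 :: 'f::{field,finite} mat monoid))"
proof (rule finite_subset)
  show "carrier (general_linear_group 2) \<subseteq> range (\<lambda>(a,b,c,d). mat2 a b c d :: 'f mat)"
  proof
    fix A :: "'f mat" assume "A \<in> carrier (general_linear_group 2)"
    then have "A \<in> carrier_mat 2 2" by (rule GL_closed)
    then obtain a b c d where "A = mat2 a b c d" by (rule mat2_cases)
    then show "A \<in> range (\<lambda>(a,b,c,d). mat2 a b c d)"
      by (intro image_eqI [of _ _ "(a,b,c,d)"]) auto
  qed
qed simp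

section \<open>Non-squares and the norm form\<close>

text \<open>Translation by 1 permutes the field, so summing all elements before and after shows that
  the odd number \<open>CARD('f)\<close> is 0 in it. If 2 were 0 as well, so would be 1.\<close>

lemma two_neq_zero_of_odd_card:
  assumes "odd (CARD('f::{field,finite}))"
  shows "(2::'f) \<noteq> 0"
proof
  assume 2: "(2::'f) = 0"
  have "(\<Sum>x\<in>(UNIV::'f set). x) = (\<Sum>x\<in>UNIV. x + 1)"
    by (rule sum.reindex_bij_witness [of _ "\<lambda>x. x + 1" "\<lambda>x. x - 1"]) auto
  then have "of_nat (CARD('f)) = (0::'f)" by (simp add: sum.distrib)
  moreover obtain m where "CARD('f) = 2 * m + 1" using assms by (rule oddE)
  ultimately have "(2::'f) * of_nat m + 1 = 0" by (metis of_nat_1 of_nat_add of_nat_mult of_nat_numeral)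
  with 2 show False by simp
qed

text \<open>If \<eta> were a square, so would be all its powers. Squaring would then be surjective,
  hence injective on a finite set, but 1 and -1 have the same square.\<close>

lemma generator_not_square:
  fixes \<eta> :: "'f::{field,finite}"
  assumes "odd (CARD('f))" and gen: "range (\<lambda>n::nat. \<eta> ^ n) = UNIV - {0}"
  shows "c\<^sup>2 \<noteq> \<eta>"
proof
  assume c: "c\<^sup>2 = \<eta>"
  have "surj (\<lambda>x::'f. x\<^sup>2)"
    unfolding surj_def
  proof
    fix y :: 'f
    show "\<exists>x. y = x\<^sup>2"
    proof (cases "y = 0")
      case False
      then obtain n where "y = \<eta> ^ n" using gen by blast
      then have "y = (c ^ n)\<^sup>2" using c by (metis power_commutes power_mult mult.commute)
      then show ?thesis by blast
    qed (auto intro: exI [of _ 0])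
  qed
  then have "inj (\<lambda>x::'f. x\<^sup>2)" by (intro finite_UNIV_surj_inj) auto
  moreover have "(1::'f)\<^sup>2 = (-1)\<^sup>2" by simp
  ultimately have "(1::'f) = -1" by (rule injD)
  then have "(2::'f) = 0" by (metis add.right_inverse one_add_one)
  then show False using two_neq_zero_of_odd_card assms(1) by blast
qed

text \<open>This is the norm of a + ib and the determinant of the Cartan matrix. A zero with
  \<open>b \<noteq> 0\<close> would make \<eta> the square of \<open>a / b\<close>.\<close>

lemma norm_form_nonzero:
  fixes \<eta> :: "'f::field"
  assumes ns: "\<And>c. c\<^sup>2 \<noteq> \<eta>" and "(a, b) \<noteq> (0, 0)"
  shows "a\<^sup>2 - \<eta> * b\<^sup>2 \<noteq> 0"
proof
  assume *: "a\<^sup>2 - \<eta> * b\<^sup>2 = 0"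
  show False
  proof (cases "b = 0")
    case True
    then show False using * assms(2) by simp
  next
    case False
    then have "(a / b)\<^sup>2 = \<eta>" using * by (simp add: power_divide field_simps)
    then show False using ns by blast
  qed
qed

section \<open>Group structure of the Cartan matrices\<close>

lemma cartanI: "(a, b) \<noteq> (0, 0) \<Longrightarrow> mat2 a (\<eta> * b) b a \<in> cartan_subgroup \<eta>"
  by (auto simp: cartan_subgroup_def)

lemma cartanE:
  assumes "A \<in> cartan_subgroup \<eta>"
  obtains a b where "A = mat2 a (\<eta> * b) b a" "(a, b) \<noteq> (0, 0)"
  using assms by (auto simp: cartan_subgroup_def)

text \<open>The inverse of a + ib is its conjugate a - ib divided by the norm
  \<open>N\<close>.\<close>

lemma cartan_inverse:
  fixes \<eta> :: "'f::field"
  assumes ns: "\<And>c. c\<^sup>2 \<noteq> \<eta>" and A: "A \<in> cartan_subgroup \<eta>"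
  obtains B where "B \<in> cartan_subgroup \<eta>" "A * B = 1\<^sub>m 2" "B * A = 1\<^sub>m 2"
proof -
  obtain a b where ab: "A = mat2 a (\<eta> * b) b a" "(a, b) \<noteq> (0, 0)" using A by (rule cartanE)
  define N where "N = a\<^sup>2 - \<eta> * b\<^sup>2"
  have N: "N \<noteq> 0" unfolding N_def using ns ab(2) by (rule norm_form_nonzero)
  define B where "B = mat2 (a / N) (\<eta> * (- b / N)) (- b / N) (a / N)"
  have "B \<in> cartan_subgroup \<eta>" unfolding B_def using ab(2) N by (intro cartanI) auto
  moreover have "a * a / N - \<eta> * b * b / N = 1"
    using N by (simp add: N_def power2_eq_square diff_divide_distrib [symmetric] mult.assoc)
  ultimately show ?thesis
    by (intro that [of B]) (auto simp: ab(1) B_def mat2_mult mat2_one mat2_eq_iff algebra_simps)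
qed

lemma cartan_carrier_mat: "A \<in> cartan_subgroup \<eta> \<Longrightarrow> A \<in> carrier_mat 2 2"
  by (elim cartanE) simp

lemma cartan_subset_GL:
  assumes "\<And>c. c\<^sup>2 \<noteq> \<eta>"
  shows "cartan_subgroup \<eta> \<subseteq> carrier (general_linear_group 2)"
proof
  fix A assume A: "A \<in> cartan_subgroup \<eta>"
  obtain B where "B \<in> cartan_subgroup \<eta>" "A * B = 1\<^sub>m 2" "B * A = 1\<^sub>m 2"
    using cartan_inverse [OF assms A] by blast
  then show "A \<in> carrier (general_linear_group 2)"
    using A by (intro GL_I) (auto simp: cartan_carrier_mat)
qed

text \<open>The point is that the product has a nonzero first column: the norm is multiplicative, so
  the norm of the product is nonzero.\<close>

lemma cartan_mult_closed:
  fixes \<eta> :: "'f::field"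
  assumes ns: "\<And>c. c\<^sup>2 \<noteq> \<eta>" and A: "A \<in> cartan_subgroup \<eta>" and B: "B \<in> cartan_subgroup \<eta>"
  shows "A * B \<in> cartan_subgroup \<eta>"
proof -
  obtain a b where ab: "A = mat2 a (\<eta> * b) b a" "(a, b) \<noteq> (0, 0)" using A by (rule cartanE)
  obtain c d where cd: "B = mat2 c (\<eta> * d) d c" "(c, d) \<noteq> (0, 0)" using B by (rule cartanE)
  \<comment> \<open>The coordinates of (a + ib)(c + id).\<close>
  define x y where "x = a * c + \<eta> * b * d" and "y = a * d + b * c"
  have "x\<^sup>2 - \<eta> * y\<^sup>2 = (a\<^sup>2 - \<eta> * b\<^sup>2) * (c\<^sup>2 - \<eta> * d\<^sup>2)"
    by (simp add: x_def y_def power2_eq_square algebra_simps)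
  then have "x\<^sup>2 - \<eta> * y\<^sup>2 \<noteq> 0"
    using norm_form_nonzero [OF ns ab(2)] norm_form_nonzero [OF ns cd(2)] by simp
  then have "(x, y) \<noteq> (0, 0)" by auto
  moreover have "A * B = mat2 x (\<eta> * y) y x"
    by (simp add: ab(1) cd(1) mat2_mult mat2_eq_iff x_def y_def algebra_simps)
  ultimately show ?thesis by (simp add: cartanI)
qed

lemma subgroup_cartan:
  fixes \<eta> :: "'f::field"
  assumes ns: "\<And>c. c\<^sup>2 \<noteq> \<eta>"
  shows "subgroup (cartan_subgroup \<eta>) (general_linear_group 2)"
proof -
  interpret group "general_linear_group 2 :: 'f mat monoid" by (rule group_GL)
  show ?thesis
  proof (rule subgroupI)
    show "cartan_subgroup \<eta> \<subseteq> carrier (general_linear_group 2)" using ns by (rule cartan_subset_GL)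
    show "cartan_subgroup \<eta> \<noteq> {}" using cartanI [of 1 0 \<eta>] by auto
  next
    fix A assume A: "A \<in> cartan_subgroup \<eta>"
    obtain B where B: "B \<in> cartan_subgroup \<eta>" "B * A = 1\<^sub>m 2"
      using cartan_inverse [OF ns A] by blast
    then have "inv\<^bsub>general_linear_group 2\<^esub> A = B"
      using A cartan_subset_GL [OF ns] by (intro inv_equality) (auto simp: GL_simps(2,3))
    then show "inv\<^bsub>general_linear_group 2\<^esub> A \<in> cartan_subgroup \<eta>" using B by simp
  next
    fix A B assume "A \<in> cartan_subgroup \<eta>" "B \<in> cartan_subgroup \<eta>"
    then show "A \<otimes>\<^bsub>general_linear_group 2\<^esub> B \<in> cartan_subgroup \<eta>"
      using cartan_mult_closed [OF ns] by (simp add: GL_simps)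
  qed
qed

text \<open>Transposition conjugated by \<open>diag(\<eta>, 1)\<close>, so that the Cartan subgroup is fixed pointwise.\<close>

definition cartan_transpose :: "'f::field \<Rightarrow> 'f mat \<Rightarrow> 'f mat" where
  "cartan_transpose \<eta> A = mat2 (A $$ (0,0)) (\<eta> * A $$ (1,0)) (A $$ (0,1) / \<eta>) (A $$ (1,1))"

lemma cartan_transpose_carrier [simp]: "cartan_transpose \<eta> A \<in> carrier_mat 2 2"
  by (simp add: cartan_transpose_def)

lemma cartan_transpose_mult:
  assumes "\<eta> \<noteq> 0" "A \<in> carrier_mat 2 2" "B \<in> carrier_mat 2 2"
  shows "cartan_transpose \<eta> (A * B) = cartan_transpose \<eta> B * cartan_transpose \<eta> A"
proof -
  obtain a b c d where A: "A = mat2 a b c d" using assms(2) by (rule mat2_cases)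
  obtain a' b' c' d' where B: "B = mat2 a' b' c' d'" using assms(3) by (rule mat2_cases)
  show ?thesis
    using assms(1)
    by (simp add: A B cartan_transpose_def mat2_mult mat2_eq_iff algebra_simps add_divide_distrib)
qed

lemma cartan_transpose_cartan:
  "\<eta> \<noteq> 0 \<Longrightarrow> A \<in> cartan_subgroup \<eta> \<Longrightarrow> cartan_transpose \<eta> A = A"
  by (elim cartanE) (simp add: cartan_transpose_def)

text \<open>A product-reversing map that fixes the identity sends inverses to inverses.\<close>

lemma cartan_transpose_GL:
  assumes "\<eta> \<noteq> 0" "A \<in> carrier (general_linear_group 2)"
  shows "cartan_transpose \<eta> A \<in> carrier (general_linear_group 2)"
proof -
  obtain B where B: "B \<in> carrier_mat 2 2" "A * B = 1\<^sub>m 2" "B * A = 1\<^sub>m 2"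
    using assms(2) by (rule GL_E)
  have one: "cartan_transpose \<eta> (1\<^sub>m 2) = 1\<^sub>m 2"
    by (simp add: cartan_transpose_def mat2_one)
  show ?thesis
    using cartan_transpose_mult [OF assms(1)] B GL_closed [OF assms(2)] one
    by (intro GL_I [of _ _ "cartan_transpose \<eta> B"]) (simp_all flip: cartan_transpose_mult [OF assms(1)])
qed

text \<open>
  Identify the plane with the quadratic extension, so that \<open>C\<close> acts by multiplications. Every matrix
  acts as \<open>z \<mapsto> \<alpha> z + \<beta> z\<^sup>q\<close>, and \<open>cartan_transpose\<close> replaces \<open>\<beta>\<close> by \<open>\<beta>\<^sup>q\<close>. Conjugation by \<open>\<gamma>\<close>
  multiplies \<open>\<beta>\<close> by \<open>\<gamma> / \<gamma>\<^sup>q\<close>, so \<open>\<gamma> = \<beta>\<^sup>q\<close> works; the matrix in the proof is a multiple of it by an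
  element of the base field.
\<close>

lemma cartan_transpose_conjugate:
  fixes \<eta> :: "'f::field"
  assumes "\<eta> \<noteq> 0" "A \<in> carrier_mat 2 2"
  shows "\<exists>k\<in>cartan_subgroup \<eta>. cartan_transpose \<eta> A * k = k * A"
proof -
  obtain a b c d where A: "A = mat2 a b c d" using assms(2) by (rule mat2_cases)
  define x y where "x = \<eta> * (a - d)" and "y = b - \<eta> * c"
  show ?thesis
  proof (cases "(x, y) = (0, 0)")
    \<comment> \<open>Here \<open>A\<close> has Cartan shape (\<beta> = 0) and is fixed by
      \<open>cartan_transpose\<close>, so the identity matrix serves; \<open>x\<close> and
      \<open>y\<close> would give the zero matrix.\<close>
    case True
    then have "cartan_transpose \<eta> A * mat2 1 (\<eta> * 0) 0 1 = mat2 1 (\<eta> * 0) 0 1 * A"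
      using assms(1) by (simp add: A x_def y_def cartan_transpose_def mat2_mult mat2_eq_iff)
    then show ?thesis using cartanI [of 1 0 \<eta>] by (intro bexI) auto
  next
    case False
    have "cartan_transpose \<eta> A * mat2 x (\<eta> * y) y x = mat2 x (\<eta> * y) y x * A"
      using assms(1)
      by (simp add: A x_def y_def cartan_transpose_def mat2_mult mat2_eq_iff field_simps)
    then show ?thesis using cartanI [OF False] by blast
  qed
qed

section \<open>One-dimensional representations and characters\<close>

lemma vectorspace_complex_line: "vectorspace complex_field complex_line"
proof -
  have "module complex_field complex_line"
  proof (rule moduleI)
    show "abelian_group complex_line"
    proof (rule abelian_groupI)
      fix x assume "x \<in> carrier complex_line"
      show "\<exists>y\<in>carrier complex_line. y \<oplus>\<^bsub>complex_line\<^esub> x = \<zero>\<^bsub>complex_line\<^esub>"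
        by (intro bexI [of _ "- x"]) (simp_all add: complex_line_def)
    qed (simp_all add: complex_line_def)
  qed (auto simp: complex_line_def algebra_simps class_cring.cring_axioms intro: class_cring.cring_axioms)
  then show ?thesis by (simp add: vectorspace_def class_field)
qed

lemma fin_dim_complex_line: "vectorspace.fin_dim complex_field complex_line"
proof -
  interpret vectorspace complex_field complex_line by (rule vectorspace_complex_line)
  have "x \<in> span {1}" for x
  proof -
    have "submodule complex_field (span {1}) complex_line"
      by (rule span_is_submodule) (simp add: complex_line_def)
    moreover have "1 \<in> span {1}" using in_own_span [of "{1}"] by (simp add: complex_line_def)
    ultimately have "x \<odot>\<^bsub>complex_line\<^esub> 1 \<in> span {1}" by (simp add: submodule_def)
    then show ?thesis by (simp add: complex_line_def)
  qed
  then have "span {1} = carrier complex_line" by (auto simp: complex_line_def)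
  then show ?thesis unfolding fin_dim_def by (intro exI [of _ "{1}"]) (auto simp: complex_line_def)
qed

lemma irreducible_one_dim:
  assumes "group G" "\<chi> \<one>\<^bsub>G\<^esub> = 1"
    and "\<And>g h. g \<in> carrier G \<Longrightarrow> h \<in> carrier G \<Longrightarrow> \<chi> (g \<otimes>\<^bsub>G\<^esub> h) = \<chi> g * \<chi> h"
  shows "irreducible_representation G complex_line (one_dim_action \<chi>)"
  unfolding irreducible_representation_def
proof (intro conjI allI impI)
  have "linear_map complex_field complex_line complex_line (one_dim_action \<chi> g)" for g
    using vectorspace_complex_line
    by (auto simp: linear_map_def mod_hom_def mod_hom_axioms_def vectorspace_def module_hom_def
        complex_line_def one_dim_action_def algebra_simps)
  then show "representation G complex_line (one_dim_action \<chi>)"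
    using assms vectorspace_complex_line fin_dim_complex_line
    by (simp add: representation_def one_dim_action_def mult.assoc)
  show "carrier complex_line \<noteq> {\<zero>\<^bsub>complex_line\<^esub>}"
    by (auto simp: complex_line_def UNIV_eq_I) (metis UNIV_I singletonD zero_neq_one)
next
  fix W assume "invariant_subspace G complex_line (one_dim_action \<chi>) W"
  then have W: "submodule complex_field W complex_line"
    by (simp add: invariant_subspace_def subspace_def)
  show "W = {\<zero>\<^bsub>complex_line\<^esub>} \<or> W = carrier complex_line"
  proof (cases "W \<subseteq> {0}")
    case True
    then show ?thesis using submodule.zero_closed [OF W] by (auto simp: complex_line_def)
  next
    case False
    then obtain w where w: "w \<in> W" "w \<noteq> 0" by blast
    have "x \<in> W" for x
      using submodule.smult_closed [OF W _ w(1), of "x / w"] w(2) by (simp add: complex_line_def)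
    then show ?thesis by (auto simp: complex_line_def)
  qed
qed

lemma units_class_ring: "Units (class_ring :: 'k::field ring) = UNIV - {0}"
proof -
  have "\<exists>y. y * x = 1 \<and> x * y = 1" if "x \<noteq> 0" for x :: 'k
    using that by (intro exI [of _ "inverse x"]) simp
  then show ?thesis by (force simp: Units_def)
qed

lemma charactersD:
  assumes "\<nu> \<in> characters (units_of (class_ring :: 'k::field ring))"
  shows "x \<noteq> 0 \<Longrightarrow> y \<noteq> 0 \<Longrightarrow> \<nu> (x * y) = \<nu> x * \<nu> y"
    and "\<nu> 1 = 1"
proof -
  show mult: "x \<noteq> 0 \<Longrightarrow> y \<noteq> 0 \<Longrightarrow> \<nu> (x * y) = \<nu> x * \<nu> y" for x y
    using assms by (simp add: characters_def hom_def units_of_def units_class_ring)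
  \<comment> \<open>Values of \<nu> are units, and a nonzero number equal to its own square is
    1.\<close>
  have "\<nu> 1 \<noteq> 0"
    using assms by (auto simp: characters_def hom_def units_of_def units_class_ring)
  with mult [of 1 1] show "\<nu> 1 = 1" by simp
qed

theorem proposition6p2:
  fixes q :: nat
    and \<eta> :: "'f::{field, finite}"
    and \<iota> :: "'f \<Rightarrow> 'k::{field, finite}"
    and i :: 'k
  assumes "odd q" and "primepow q"
    and "CARD('f) = q" and "CARD('k) = q\<^sup>2"
    and "field_hom \<iota>"
    and "range (\<lambda>n::nat. \<eta> ^ n) = UNIV - {0}"
    and "i\<^sup>2 = \<iota> \<eta>"
  shows "\<forall>\<nu> \<in> characters (units_of (class_ring :: 'k ring)).
           multiplicity_free_triple (general_linear_group 2) (cartan_subgroup \<eta>)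
             complex_line (one_dim_action (\<nu> \<circ> cartan_to_ext \<iota> i))"
proof
  fix \<nu> assume \<nu>: "\<nu> \<in> characters (units_of (class_ring :: 'k ring))"
  interpret iota: field_hom \<iota> by fact
  let ?G = "general_linear_group 2 :: 'f mat monoid" and ?C = "cartan_subgroup \<eta>"
  define \<chi> where "\<chi> = \<nu> \<circ> cartan_to_ext \<iota> i"
  have ns: "c\<^sup>2 \<noteq> \<eta>" for c using generator_not_square assms(1,3,6) by blast
  have \<eta>0: "\<eta> \<noteq> 0" using ns [of 0] by simp
  \<comment> \<open>The extra factor \<open>z\<close> lets the rule rewrite inside the right-nested
    products that \<open>algebra_simps\<close> produces.\<close>
  have ii: "i * (i * z) = \<iota> \<eta> * z" for z
    using assms(7) by (simp add: power2_eq_square mult.assoc [symmetric])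
  \<comment> \<open>Multiplicativity of \<nu> is available at nonzero arguments only. Multiplying by
    the conjugate reduces the claim to the norm form, as \<iota> sends only 0 to 0.\<close>
  have ext_nonzero: "cartan_to_ext \<iota> i A \<noteq> 0" if A: "A \<in> ?C" for A
  proof
    assume 0: "cartan_to_ext \<iota> i A = 0"
    obtain a b where ab: "A = mat2 a (\<eta> * b) b a" "(a, b) \<noteq> (0, 0)" using A by (rule cartanE)
    have "\<iota> a + i * \<iota> b = 0" using 0 by (simp add: ab(1) cartan_to_ext_def)
    then have "(\<iota> a + i * \<iota> b) * (\<iota> a - i * \<iota> b) = 0" by simp
    then have "\<iota> (a\<^sup>2 - \<eta> * b\<^sup>2) = 0"
      by (simp add: iota.hom_add iota.hom_mult iota.hom_minus power2_eq_square algebra_simps ii)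
    then show False using norm_form_nonzero [OF ns ab(2)] by simp
  qed
  have ext_mult: "cartan_to_ext \<iota> i (A * B) = cartan_to_ext \<iota> i A * cartan_to_ext \<iota> i B"
    if "A \<in> ?C" "B \<in> ?C" for A B
    using that by (elim cartanE)
      (simp add: cartan_to_ext_def mat2_mult iota.hom_add iota.hom_mult iota.hom_minus algebra_simps ii)
  have chi_mat_mult: "\<chi> (A * B) = \<chi> A * \<chi> B" if "A \<in> ?C" "B \<in> ?C" for A B
    using that by (simp add: \<chi>_def ext_mult charactersD(1) [OF \<nu>] ext_nonzero)
  have chi_mat_one: "\<chi> (1\<^sub>m 2) = 1"
    by (simp add: \<chi>_def cartan_to_ext_def charactersD(2) [OF \<nu>])
  note sub = subgroup_cartan [OF ns]
  interpret G: group ?G by (rule group_GL)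
  interpret twisted_gelfand_pair ?G ?C \<chi> "cartan_transpose \<eta>"
  proof (intro twisted_gelfand_pair.intro twisted_gelfand_pair_axioms.intro)
    fix A assume A: "A \<in> carrier ?G"
    \<comment> \<open>With \<open>l\<close> the inverse of \<open>k\<close>, the conjugation becomes
      the required factorization, and \<open>\<chi> k * \<chi> l\<close> is \<chi> at the identity
      matrix.\<close>
    obtain k where k: "k \<in> ?C" "cartan_transpose \<eta> A * k = k * A"
      using cartan_transpose_conjugate [OF \<eta>0 GL_closed [OF A]] by blast
    obtain l where l: "l \<in> ?C" "k * l = 1\<^sub>m 2" using cartan_inverse [OF ns k(1)] by blast
    have "cartan_transpose \<eta> A = cartan_transpose \<eta> A * (k * l)"
      using l(2) by (simp add: right_mult_one_mat [OF cartan_transpose_carrier])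
    also have "\<dots> = cartan_transpose \<eta> A * k * l"
      by (rule assoc_mult_mat [OF cartan_transpose_carrier cartan_carrier_mat [OF k(1)]
            cartan_carrier_mat [OF l(1)], symmetric])
    also have "\<dots> = k * A * l" by (simp only: k(2))
    finally have "cartan_transpose \<eta> A = k * A * l" .
    moreover have "\<chi> k * \<chi> l = 1" using chi_mat_mult [OF k(1) l(1)] l(2) chi_mat_one by simp
    ultimately show "\<exists>k\<in>?C. \<exists>l\<in>?C.
        cartan_transpose \<eta> A = k \<otimes>\<^bsub>?G\<^esub> A \<otimes>\<^bsub>?G\<^esub> l \<and> \<chi> k * \<chi> l = 1"
      using k(1) l(1) by (auto simp: GL_simps)
  qed (auto simp: group_GL finite_GL2 sub chi_mat_mult chi_mat_one cartan_transpose_GL \<eta>0 cartan_transpose_cartan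
      GL_simps(2,3) cartan_transpose_mult GL_closed)
  have "irreducible_representation (?G\<lparr>carrier := ?C\<rparr>) complex_line (one_dim_action \<chi>)"
    using G.subgroup_imp_group [OF sub]
    by (intro irreducible_one_dim) (auto simp: GL_simps chi_mat_mult chi_mat_one)
  then show "multiplicity_free_triple ?G ?C complex_line (one_dim_action (\<nu> \<circ> cartan_to_ext \<iota> i))"
    using multiplicity_free_induced sub finite_GL2 group_GL
    by (simp add: multiplicity_free_triple_def \<chi>_def)
qed

end
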